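(* Let $\Omega\subset\mathbf{C}$ be a domain, let $X:\Omega\to\mathbf{R}^3$ be a regular harmonic surface, and let $\mathbf{n}=\frac{X_x\times X_y}{\|X_x\times X_y\|}:\Omega\to S^2$ be its Gauss map. Then the dilatation and the distortion function of $\mathbf{n}$ coincide with the dilatation and the distortion function of $X$ wherever the Gauss map is regular. That is, for every $z\in\Omega$ with $$\frac{\partial \mathbf{n}}{\partial x}(z)\times\frac{\partial \mathbf{n}}{\partial y}(z)\neq 0,$$ one has $$\mathfrak{D}_{\mathbf{n}}(z)=\mathfrak{D}_{X}(z)\qquad\text{and}\qquad d_X(z)=d_{\mathbf{n}}(z).$$
   Context: A domain is a connected open set; $z=x+iy$, subscripts $x,y$ denote partial derivatives, $\times$ is the cross product and $\|\cdot\|$ the Euclidean norm in $\mathbf{R}^3$. A harmonic surface is a map $X=(a,b,c):\Omega\to\mathbf{R}^3$ whose coordinate functions are harmonic functions of $(x,y)$; it is regular (an immersion) if $X_x\times X_y\ne 0$ at every point. Distortion function. For a smooth map $Y:\Omega\to\mathbf{R}^3$ and a point where $Y_x\times Y_y\neq0$, $$\mathfrak{D}_Y=\frac{\|Y_x\|^2+\|Y_y\|^2}{2\|Y_x\times Y_y\|}.$$ This is applied both to $Y=X$ and to $Y=\mathbf{n}$ (regarded as a map into $S^2\subset\mathbf{R}^3$). Dilatation. For an orientation preserving smooth map $\varphi$ between plane domains, $d_\varphi=|\varphi_{\bar z}/\varphi_z|$. For the immersion $X$, the dilatation is $d_X=d_\varphi$, where, near the given point, $\varphi=\tilde X^{-1}\circ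 X$ and $\tilde X$ is an isothermal parametrization of the surface (that is, $\|\tilde X_u\|=\|\tilde X_v\|$ and $\langle \tilde X_u,\tilde X_v\rangle=0$ in its parameters $u,v$) inducing the same orientation as $X$; one has $\mathfrak{D}_X=\frac{|\varphi_z|^2+|\varphi_{\bar z}|^2}{|\varphi_z|^2-|\varphi_{\bar z}|^2}$. For the Gauss map, $d_{\mathbf{n}}=d_{\mathfrak{g}}=|\mathfrak{g}_{\bar z}/\mathfrak{g}_z|$, where $\mathfrak{g}=f\circ\mathbf{n}$ is the complex Gauss map and $f:S^2\setminus\{(0,0,1)\}\to\mathbf{R}^2\cong\mathbf{C}$, $f(x_1,x_2,x_3)=\left(\frac{x_1}{1-x_3},\frac{x_2}{1-x_3}\right)$ is stereographic projection (at points with $\mathbf{n}(z)=(0,0,1)$ one first composes $\mathbf{n}$ with a rotation of $S^2$, which does not affect the value); one has $\mathfrak{D}_{\mathbf{n}}=\frac{|\mathfrak{g}_z|^2+|\mathfrak{g}_{\bar z}|^2}{|\mathfrak{g}_z|^2-|\mathfrak{g}_{\bar z}|^2}$. *)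

theory Defs
  imports "HOL-Analysis.Analysis"
begin

unbundle cross3_syntax

text \<open>The plane is the type \<^typ>\<open>complex\<close>, with \<open>z = x + \<i> y\<close>.\<close>

definition domain :: "complex set \<Rightarrow> bool" where
  "domain S \<longleftrightarrow> open S \<and> connected S"

definition pdx :: "(complex \<Rightarrow> 'a::real_normed_vector) \<Rightarrow> complex \<Rightarrow> 'a" where
  "pdx f z = vector_derivative (\<lambda>t::real. f (z + of_real t)) (at 0)"

definition pdy :: "(complex \<Rightarrow> 'a::real_normed_vector) \<Rightarrow> complex \<Rightarrow> 'a" where
  "pdy f z = vector_derivative (\<lambda>t::real. f (z + \<i> * of_real t)) (at 0)"

text \<open>\<open>Ck_on k f S\<close>: \<open>f\<close> is of class \<open>C\<^sup>k\<close> on the open set \<open>S\<close>.\<close>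

primrec Ck_on :: "nat \<Rightarrow> (complex \<Rightarrow> 'a::real_normed_vector) \<Rightarrow> complex set \<Rightarrow> bool" where
  "Ck_on 0 f S \<longleftrightarrow> continuous_on S f"
| "Ck_on (Suc k) f S \<longleftrightarrow>
     (\<forall>z\<in>S. f differentiable (at z)) \<and> Ck_on k (pdx f) S \<and> Ck_on k (pdy f) S"

definition smooth_on :: "(complex \<Rightarrow> 'a::real_normed_vector) \<Rightarrow> complex set \<Rightarrow> bool" where
  "smooth_on f S \<longleftrightarrow> (\<forall>k. Ck_on k f S)"

definition harmonic_on :: "(complex \<Rightarrow> real) \<Rightarrow> complex set \<Rightarrow> bool" where
  "harmonic_on u S \<longleftrightarrow> Ck_on 2 u S \<and> (\<forall>z\<in>S. pdx (pdx u) z + pdy (pdy u) z = 0)"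

definition immersion_on :: "(complex \<Rightarrow> real^3) \<Rightarrow> complex set \<Rightarrow> bool" where
  "immersion_on X S \<longleftrightarrow> (\<forall>z\<in>S. pdx X z \<times> pdy X z \<noteq> 0)"

definition regular_harmonic_surface :: "(complex \<Rightarrow> real^3) \<Rightarrow> complex set \<Rightarrow> bool" where
  "regular_harmonic_surface X S \<longleftrightarrow>
     (\<forall>i. harmonic_on (\<lambda>z. X z $ i) S) \<and> immersion_on X S"

definition gauss_map :: "(complex \<Rightarrow> real^3) \<Rightarrow> complex \<Rightarrow> real^3" where
  "gauss_map X z = (pdx X z \<times> pdy X z) /\<^sub>R norm (pdx X z \<times> pdy X z)"

definition distortion :: "(complex \<Rightarrow> real^3) \<Rightarrow> complex \<Rightarrow> real" where
  "distortion Y z =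
     ((norm (pdx Y z))\<^sup>2 + (norm (pdy Y z))\<^sup>2) / (2 * norm (pdx Y z \<times> pdy Y z))"

definition wirtinger :: "(complex \<Rightarrow> complex) \<Rightarrow> complex \<Rightarrow> complex" where
  "wirtinger \<phi> z = (pdx \<phi> z - \<i> * pdy \<phi> z) / 2"

definition wirtinger_bar :: "(complex \<Rightarrow> complex) \<Rightarrow> complex \<Rightarrow> complex" where
  "wirtinger_bar \<phi> z = (pdx \<phi> z + \<i> * pdy \<phi> z) / 2"

definition dilatation :: "(complex \<Rightarrow> complex) \<Rightarrow> complex \<Rightarrow> real" where
  "dilatation \<phi> z = cmod (wirtinger_bar \<phi> z / wirtinger \<phi> z)"

definition isothermal_on :: "(complex \<Rightarrow> real^3) \<Rightarrow> complex set \<Rightarrow> bool" where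
  "isothermal_on Y V \<longleftrightarrow> smooth_on Y V \<and> immersion_on Y V \<and>
     (\<forall>w\<in>V. norm (pdx Y w) = norm (pdy Y w) \<and> pdx Y w \<bullet> pdy Y w = 0)"

text \<open>The transition map \<open>Y\<inverse> \<circ> X\<close>, where \<open>Y\<close> is injective on \<open>V\<close>.\<close>

definition transition ::
  "(complex \<Rightarrow> real^3) \<Rightarrow> complex set \<Rightarrow> (complex \<Rightarrow> real^3) \<Rightarrow> complex \<Rightarrow> complex" where
  "transition Y V X = the_inv_into V Y \<circ> X"

text \<open>\<open>Y\<close> on \<open>V\<close> is an isothermal parametrization of the piece \<open>X ` U\<close> of the surface. The
  orientations induced by \<open>X\<close> and \<open>Y\<close> agree when the unit normals do; this makes the transition
  map, which is a bijection from \<open>U\<close> onto \<open>V\<close>, orientation preserving.\<close>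

definition isothermal_parametrization ::
  "(complex \<Rightarrow> real^3) \<Rightarrow> complex set \<Rightarrow> (complex \<Rightarrow> real^3) \<Rightarrow> complex set \<Rightarrow> bool" where
  "isothermal_parametrization X U Y V \<longleftrightarrow>
     domain U \<and> domain V \<and> isothermal_on Y V \<and>
     inj_on X U \<and> inj_on Y V \<and> Y ` V = X ` U \<and>
     smooth_on (transition Y V X) U \<and>
     (\<forall>w\<in>U. gauss_map Y (transition Y V X w) = gauss_map X w)"

text \<open>The value does not depend on the isothermal parametrization chosen near \<open>z\<close>, and one
  exists near every point of a regular harmonic surface, so the description is proper there.\<close>

definition surface_dilatation :: "(complex \<Rightarrow> real^3) \<Rightarrow> complex \<Rightarrow> real" where
  "surface_dilatation X z =
     (THE d. \<exists>U Y V. z \<in> U \<and> isothermal_parametrization X U Y V \<and>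
                     d = dilatation (transition Y V X) z)"

definition north_pole :: "real^3" where
  "north_pole = vector [0, 0, 1]"

definition stereographic :: "real^3 \<Rightarrow> complex" where
  "stereographic p = Complex (p$1 / (1 - p$3)) (p$2 / (1 - p$3))"

text \<open>For a map \<open>n\<close> into the unit sphere. The rotation is the identity unless \<open>n z\<close> is the
  centre of the projection.\<close>

definition projecting_rotation :: "real^3 \<Rightarrow> real^3^3" where
  "projecting_rotation p =
     (if p \<noteq> north_pole then mat 1
      else (SOME R. rotation_matrix R \<and> R *v p \<noteq> north_pole))"

definition spherical_dilatation :: "(complex \<Rightarrow> real^3) \<Rightarrow> complex \<Rightarrow> real" where
  "spherical_dilatation n z =
     dilatation (\<lambda>w. stereographic (projecting_rotation (n z) *v n w)) z"

end

(*
  Write the metric of X as E dx^2 + 2 F dx dy + G dy^2. The coordinates of X_x - i X_y are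
  holomorphic, so the second fundamental form is trace free in the coordinates x, y: the inner
  products of n_x, n_y with X_x, X_y are -L, -M and -M, L. Hence n_x \<times> n_y is a negative multiple
  of n, so that stereographic projection from the north pole makes the Gauss map orientation
  preserving, and |n_x|^2 + |n_y|^2 is proportional to E + G with the factor that makes the
  distortions agree. Both dilatations are sqrt ((D - 1) / (D + 1)) for the common distortion D.

  What remains is the existence of an isothermal parametrization. The metric is real analytic: its
  Beltrami coefficient is the restriction to \<zeta> = cnj z of a holomorphic function \<mu>(z, \<zeta>). The
  equation w_\<zeta> = \<mu> w_z with w(z, 0) = z is solved by a series \<Sum> a_n(z) \<zeta>^n, which converges by
  Cauchy's inequality on shrinking discs (as in the Cauchy-Kovalevskaya theorem), and w(z, cnj z)
  is the isothermal coordinate.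
*)
theory Submission
  imports Defs "HOL-Complex_Analysis.Complex_Analysis"
begin

subsection \<open>Functions of class C^k in the plane\<close>

text \<open>The obstacle is that \<open>surface_dilatation\<close> is a definite description over
  isothermal charts: it can be evaluated only when some chart exists near the point and all charts
  give the same number. Agreement is the easy half. The metric of X is a multiple of the metric
  pulled back by the transition map, so that map has the distortion of X, and equality of the unit
  normals makes its Jacobian positive. Existence takes most of the work. For a general smooth metric
  it is a theorem on elliptic equations; here the holomorphic functions behind X turn it into a
  question about the convergence of a power series with holomorphic coefficients. Since a chart has
  to be of class C^k for every k, and is built as X composed with the inverse of the isothermal
  coordinate, composition, inversion and the sum of the series all have to be controlled in these
  classes.

  The sign pattern of the second fundamental form comes from differentiating the orthogonality of n
  to X_x and X_y: the diagonal entries are, up to sign, the products of n with X_xx and X_yy, and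
  these two vectors add up to zero.\<close>

lemma pd_of_has_derivative:
  assumes "(f has_derivative D) (at z)"
  shows "pdx f z = D 1" "pdy f z = D \<i>"
proof -
  have lin: "linear D" using assms has_derivative_linear by blast
  have 1: "((\<lambda>t::real. z + c * of_real t) has_derivative (\<lambda>t. c * of_real t)) (at 0)" for c
    by (auto intro!: derivative_eq_intros)
  have 2: "((\<lambda>t::real. f (z + c * of_real t)) has_vector_derivative D c) (at 0)" for c
  proof -
    have "((\<lambda>t::real. f (z + c * of_real t)) has_derivative (\<lambda>t. D (c * of_real t))) (at 0)"
      using diff_chain_at[OF 1[of c], of f D] assms by (simp add: o_def)
    moreover have "D (c * of_real t) = t *\<^sub>R D c" for t
      using linear_scale[OF lin, of t c] by (simp add: scaleR_conv_of_real mult.commute)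
    ultimately show ?thesis by (simp add: has_vector_derivative_def)
  qed
  show "pdx f z = D 1" "pdy f z = D \<i>"
    unfolding pdx_def pdy_def using 2[of 1] 2[of \<i>] by (simp_all add: vector_derivative_at)
qed

lemma has_derivative_pd:
  assumes "f differentiable (at z)"
  shows "(f has_derivative (\<lambda>h. Re h *\<^sub>R pdx f z + Im h *\<^sub>R pdy f z)) (at z)"
proof -
  obtain D where D: "(f has_derivative D) (at z)" using assms differentiable_def by blast
  have lin: "linear D" using D has_derivative_linear by blast
  have eq: "D h = Re h *\<^sub>R D 1 + Im h *\<^sub>R D \<i>" for h
  proof -
    have "D h = D (Re h *\<^sub>R 1 + Im h *\<^sub>R \<i>)"
      by (rule arg_cong[of _ _ D]) (simp add: complex_eq_iff)
    then show ?thesis using lin by (simp add: linear_add linear_scale)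
  qed
  show ?thesis
    by (rule has_derivative_eq_rhs[OF D]) (simp add: fun_eq_iff pd_of_has_derivative[OF D] eq[symmetric])
qed

text \<open>The rules of calculus below are mostly obtained for the total derivative; both partial
  derivatives are then read off at once, instead of arguing along each axis.\<close>

lemma has_derivative_pdI:
  "(f has_derivative D) (at z) \<Longrightarrow> (\<And>h. D h = Re h *\<^sub>R a + Im h *\<^sub>R b) \<Longrightarrow>
    f differentiable (at z) \<and> pdx f z = a \<and> pdy f z = b"
  using pd_of_has_derivative[of f D z] by (auto simp: differentiable_def)

lemma pd_cong:
  assumes "open S" "z \<in> S" "\<And>w. w \<in> S \<Longrightarrow> f w = g w"
  shows "pdx f z = pdx g z" "pdy f z = pdy g z"
proof -
  have *: "\<forall>\<^sub>F t in nhds (0::real). z + c * of_real t \<in> S" for c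
  proof -
    have "((\<lambda>t::real. z + c * of_real t) \<longlongrightarrow> z + c * of_real 0) (nhds 0)"
      by (intro tendsto_intros filterlim_ident) 
    then show ?thesis using assms(1,2) by (simp add: topological_tendstoD)
  qed
  have "\<forall>\<^sub>F t in nhds (0::real). f (z + c * of_real t) = g (z + c * of_real t)" for c
    using *[of c] by eventually_elim (simp add: assms)
  from this[of 1] this[of \<i>] show "pdx f z = pdx g z" "pdy f z = pdy g z"
    unfolding pdx_def pdy_def by (auto intro!: vector_derivative_cong_eq)
qed

lemma differentiable_cong_open:
  assumes "open S" "z \<in> S" "\<And>w. w \<in> S \<Longrightarrow> f w = g w" "f differentiable (at z)"
  shows "g differentiable (at z)"
  using assms unfolding differentiable_def
  by (meson has_derivative_transform_within_open)

lemma Ck_on_cong: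
  assumes "open S" "\<And>w. w \<in> S \<Longrightarrow> f w = g w" "Ck_on k f S"
  shows "Ck_on k g S"
  using assms(2,3)
proof (induction k arbitrary: f g)
  case 0 then show ?case by (simp cong: continuous_on_cong)
next
  case (Suc k)
  have "g differentiable (at z)" if "z \<in> S" for z
    using differentiable_cong_open[OF assms(1) that Suc.prems(1)] Suc.prems(2) that by simp
  moreover have "Ck_on k (pdx g) S"
  proof (rule Suc.IH[of "pdx f"])
    show "pdx f w = pdx g w" if "w \<in> S" for w
      by (rule pd_cong(1)[of S w f g]) (use assms(1) that Suc.prems(1) in simp_all)
  qed (use Suc.prems(2) in simp)
  moreover have "Ck_on k (pdy g) S"
  proof (rule Suc.IH[of "pdy f"])
    show "pdy f w = pdy g w" if "w \<in> S" for w
      by (rule pd_cong(2)[of S w f g]) (use assms(1) that Suc.prems(1) in simp_all)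
  qed (use Suc.prems(2) in simp)
  ultimately show ?case by simp
qed

lemma continuous_on_if_differentiable:
  "(\<And>z. z \<in> S \<Longrightarrow> f differentiable (at z)) \<Longrightarrow> continuous_on S f"
  by (simp add: continuous_at_imp_continuous_on differentiable_imp_continuous_within)

lemma Ck_on_SucD: "Ck_on (Suc k) f S \<Longrightarrow> Ck_on k f S"
proof (induction k arbitrary: f)
  case 0 then show ?case by (simp add: continuous_on_if_differentiable)
next
  case (Suc k)
  have f: "\<forall>z\<in>S. f differentiable (at z)" "Ck_on (Suc k) (pdx f) S" "Ck_on (Suc k) (pdy f) S"
    using Suc.prems by simp_all
  then show ?case using Suc.IH[OF f(2)] Suc.IH[OF f(3)] unfolding Ck_on.simps(2)[of k f] by blast
qed

lemma Ck_on_le: "Ck_on k f S \<Longrightarrow> m \<le> k \<Longrightarrow> Ck_on m f S"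
  by (induction k) (auto simp: le_Suc_eq dest: Ck_on_SucD simp del: Ck_on.simps)

lemma Ck_on_subset: "Ck_on k f S \<Longrightarrow> T \<subseteq> S \<Longrightarrow> Ck_on k f T"
  by (induction k arbitrary: f) (auto intro: continuous_on_subset)

text \<open>The recursion in \<open>Ck_on\<close> runs through the total functions
  \<open>pdx f\<close> and \<open>pdy f\<close>, whereas product and chain rules give formulas that
  hold on S only. As S is open, such formulas may replace the partial derivatives. The closure
  properties below are inductions through this rule.\<close>

lemma Ck_on_SucI:
  assumes "open S"
    and "\<And>z. z \<in> S \<Longrightarrow> f differentiable (at z) \<and> pdx f z = g z \<and> pdy f z = h z"
    and "Ck_on k g S" "Ck_on k h S"
  shows "Ck_on (Suc k) f S"
  using assms Ck_on_cong[OF assms(1), of g "pdx f" k] Ck_on_cong[OF assms(1), of h "pdy f" k] by simp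

lemma Ck_on_bounded_linear:
  assumes "open S" "bounded_linear l" "Ck_on k f S"
  shows "Ck_on k (\<lambda>z. l (f z)) S"
  using assms(3)
proof (induction k arbitrary: f)
  case 0 then show ?case using bounded_linear.continuous_on[OF assms(2)] by simp
next
  case (Suc k)
  interpret l: bounded_linear l by fact
  have "(\<lambda>z. l (f z)) differentiable (at z) \<and> pdx (\<lambda>z. l (f z)) z = l (pdx f z)
      \<and> pdy (\<lambda>z. l (f z)) z = l (pdy f z)" if "z \<in> S" for z
    by (rule has_derivative_pdI[OF l.has_derivative[OF has_derivative_pd]])
      (use Suc.prems that in \<open>auto simp: l.add l.scaleR\<close>)
  then show ?case by (rule Ck_on_SucI[OF assms(1)]) (use Suc in simp_all)
qed

lemma Ck_on_add:
  assumes "open S" "Ck_on k f S" "Ck_on k g S"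
  shows "Ck_on k (\<lambda>z. f z + g z) S"
  using assms(2,3)
proof (induction k arbitrary: f g)
  case 0 then show ?case by (auto intro: continuous_intros)
next
  case (Suc k)
  have "(\<lambda>z. f z + g z) differentiable (at z) \<and> pdx (\<lambda>z. f z + g z) z = pdx f z + pdx g z
      \<and> pdy (\<lambda>z. f z + g z) z = pdy f z + pdy g z" if "z \<in> S" for z
    by (rule has_derivative_pdI[OF has_derivative_add[OF has_derivative_pd has_derivative_pd]])
      (use Suc.prems that in \<open>auto simp: algebra_simps\<close>)
  moreover have "Ck_on k (\<lambda>z. pdx f z + pdx g z) S" "Ck_on k (\<lambda>z. pdy f z + pdy g z) S"
    using Suc.prems by (simp_all add: Suc.IH)
  ultimately show ?case by (rule Ck_on_SucI[OF assms(1)])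
qed

lemma Ck_on_bilinear:
  assumes "open S" "bounded_bilinear b" "Ck_on k f S" "Ck_on k g S"
  shows "Ck_on k (\<lambda>z. b (f z) (g z)) S"
  using assms(3,4)
proof (induction k arbitrary: f g)
  case 0 then show ?case using bounded_bilinear.continuous_on[OF assms(2)] by auto
next
  case (Suc k)
  interpret b: bounded_bilinear b by fact
  have "(\<lambda>z. b (f z) (g z)) differentiable (at z)
      \<and> pdx (\<lambda>z. b (f z) (g z)) z = b (f z) (pdx g z) + b (pdx f z) (g z)
      \<and> pdy (\<lambda>z. b (f z) (g z)) z = b (f z) (pdy g z) + b (pdy f z) (g z)" if "z \<in> S" for z
    by (rule has_derivative_pdI[OF b.FDERIV[OF has_derivative_pd has_derivative_pd]])
      (use Suc.prems that in \<open>auto simp: algebra_simps b.add_left b.add_right b.scaleR_left b.scaleR_right\<close>)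
  moreover have "Ck_on k f S" "Ck_on k g S" using Suc.prems Ck_on_SucD by blast+
  then have "Ck_on k (\<lambda>z. b (f z) (pdx g z) + b (pdx f z) (g z)) S"
      "Ck_on k (\<lambda>z. b (f z) (pdy g z) + b (pdy f z) (g z)) S"
    using Suc.prems by (simp_all add: Suc.IH Ck_on_add[OF assms(1)])
  ultimately show ?case by (rule Ck_on_SucI[OF assms(1)])
qed

lemma Ck_on_const: "open S \<Longrightarrow> Ck_on k (\<lambda>z. c) S"
proof (induction k arbitrary: c)
  case (Suc k)
  have "(\<lambda>z. c) differentiable (at z) \<and> pdx (\<lambda>z. c) z = 0 \<and> pdy (\<lambda>z. c) z = 0" for z
    by (rule has_derivative_pdI[OF has_derivative_const]) simp
  then show ?case using Suc by (intro Ck_on_SucI) auto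
qed auto

text \<open>The derivative of 1/f is -f'/f^2. It contains 1/f but no derivative of it, so the
  inductive hypothesis for the same f suffices.\<close>

lemma Ck_on_inverse:
  fixes f :: "complex \<Rightarrow> real"
  assumes "open S" "\<And>z. z \<in> S \<Longrightarrow> f z \<noteq> 0" "Ck_on k f S"
  shows "Ck_on k (\<lambda>z. inverse (f z)) S"
  using assms(3)
proof (induction k)
  case 0 then show ?case using assms(2) by (auto intro!: continuous_intros)
next
  case (Suc k)
  let ?g = "\<lambda>z. inverse (f z) * inverse (f z)"
  have "(\<lambda>z. inverse (f z)) differentiable (at z)
      \<and> pdx (\<lambda>z. inverse (f z)) z = - (pdx f z * ?g z)
      \<and> pdy (\<lambda>z. inverse (f z)) z = - (pdy f z * ?g z)" if "z \<in> S" for z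
    by (rule has_derivative_pdI[OF Deriv.has_derivative_inverse[OF _ has_derivative_pd]])
      (use Suc.prems assms(2) that in \<open>auto simp: algebra_simps\<close>)
  moreover have "Ck_on k (\<lambda>z. inverse (f z)) S" by (rule Suc.IH[OF Ck_on_SucD[OF Suc.prems]])
  then have "Ck_on k ?g S" by (intro Ck_on_bilinear[OF assms(1) bounded_bilinear_mult])
  then have "Ck_on k (\<lambda>z. - (pdx f z * ?g z)) S" "Ck_on k (\<lambda>z. - (pdy f z * ?g z)) S"
    using Suc.prems
    by (auto intro!: Ck_on_bounded_linear[OF assms(1) bounded_linear_minus[OF bounded_linear_ident]]
          Ck_on_bilinear[OF assms(1) bounded_bilinear_mult])
  ultimately show ?case by (rule Ck_on_SucI[OF assms(1)])
qed

lemma pd_compose: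
  fixes v :: "complex \<Rightarrow> complex"
  assumes "v differentiable (at z)" "f differentiable (at (v z))"
  shows "(\<lambda>w. f (v w)) differentiable (at z)
      \<and> pdx (\<lambda>w. f (v w)) z = Re (pdx v z) *\<^sub>R pdx f (v z) + Im (pdx v z) *\<^sub>R pdy f (v z)
      \<and> pdy (\<lambda>w. f (v w)) z = Re (pdy v z) *\<^sub>R pdx f (v z) + Im (pdy v z) *\<^sub>R pdy f (v z)"
  by (rule has_derivative_pdI[OF
      diff_chain_at[OF has_derivative_pd[OF assms(1)] has_derivative_pd[OF assms(2)], unfolded o_def]])
    (simp add: algebra_simps)

lemma Ck_on_compose:
  fixes v :: "complex \<Rightarrow> complex"
  assumes "open S" "open T" "v ` S \<subseteq> T" "Ck_on k v S" "Ck_on k f T"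
  shows "Ck_on k (\<lambda>z. f (v z)) S"
  using assms(4,5)
proof (induction k arbitrary: f)
  case 0 then show ?case using assms(3) by (auto intro: continuous_on_compose2)
next
  case (Suc k)
  have "Ck_on k v S" using Suc.prems Ck_on_SucD by blast
  then have 1: "Ck_on k (\<lambda>z. pdx f (v z)) S" "Ck_on k (\<lambda>z. pdy f (v z)) S"
    using Suc by auto
  show ?case
  proof (rule Ck_on_SucI[OF assms(1)])
    show "(\<lambda>w. f (v w)) differentiable (at z)
      \<and> pdx (\<lambda>w. f (v w)) z = Re (pdx v z) *\<^sub>R pdx f (v z) + Im (pdx v z) *\<^sub>R pdy f (v z)
      \<and> pdy (\<lambda>w. f (v w)) z = Re (pdy v z) *\<^sub>R pdx f (v z) + Im (pdy v z) *\<^sub>R pdy f (v z)"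
      if "z \<in> S" for z
      using that Suc.prems assms(3) by (intro pd_compose) auto
  qed (use Suc.prems in \<open>auto intro!: Ck_on_add[OF assms(1)] Ck_on_bilinear[OF assms(1) bounded_bilinear_scaleR] 1
         Ck_on_bounded_linear[OF assms(1) bounded_linear_Re] Ck_on_bounded_linear[OF assms(1) bounded_linear_Im]\<close>)
qed

section \<open>Jacobians and inverse functions in the plane\<close>

definition jacobian :: "(complex \<Rightarrow> complex) \<Rightarrow> complex \<Rightarrow> real" where
  "jacobian w z = Re (pdx w z) * Im (pdy w z) - Im (pdx w z) * Re (pdy w z)"

text \<open>Cramer's rule: the two partial derivatives are the columns of the adjugate of the
  derivative of w, divided by its determinant.\<close>

lemma pd_inverse:
  fixes v w :: "complex \<Rightarrow> complex"
  assumes "open S" "\<And>z. z \<in> S \<Longrightarrow> w differentiable (at z)" "\<And>z. z \<in> S \<Longrightarrow> v (w z) = z"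
    and "z \<in> S" "jacobian w z \<noteq> 0"
  shows "v differentiable (at (w z))
    \<and> pdx v (w z) = inverse (jacobian w z) *\<^sub>R Complex (Im (pdy w z)) (- Im (pdx w z))
    \<and> pdy v (w z) = inverse (jacobian w z) *\<^sub>R Complex (- Re (pdy w z)) (Re (pdx w z))"
proof -
  let ?D = "\<lambda>h. Re h *\<^sub>R pdx w z + Im h *\<^sub>R pdy w z"
  let ?E = "\<lambda>h. Re h *\<^sub>R (inverse (jacobian w z) *\<^sub>R Complex (Im (pdy w z)) (- Im (pdx w z)))
             + Im h *\<^sub>R (inverse (jacobian w z) *\<^sub>R Complex (- Re (pdy w z)) (Re (pdx w z)))"
  have "(v has_derivative ?E) (at (w z))"
  proof (rule has_derivative_inverse_strong[OF assms(1,4), where f' = ?D])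
    show "v (w y) = y" if "y \<in> S" for y using that assms(3) by simp
    show "continuous_on S w"
      using assms(2) by (rule continuous_on_if_differentiable)
    show "(w has_derivative ?D) (at z)" using assms by (intro has_derivative_pd) auto
    have "?D (?E h) = (jacobian w z * inverse (jacobian w z)) *\<^sub>R h" for h
      by (simp add: complex_eq_iff jacobian_def) (simp add: algebra_simps)
    then show "?D \<circ> ?E = id" using assms(5) by (auto simp: fun_eq_iff)
  qed
  then show ?thesis by (rule has_derivative_pdI) simp
qed

text \<open>Bootstrapping. The partial derivatives of v are \<open>?P\<close> and \<open>?Q\<close>
  composed with v itself, and \<open>?P\<close>, \<open>?Q\<close> are of class C^k. Hence if v is
  of class C^m with m \<le> k, so are its partial derivatives, and v is of class C^(m+1).\<close>

lemma Ck_on_inverse_function: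
  fixes v w :: "complex \<Rightarrow> complex"
  assumes "open S" "open (w ` S)" "Ck_on (Suc k) w S" "\<And>z. z \<in> S \<Longrightarrow> v (w z) = z"
    and "\<And>z. z \<in> S \<Longrightarrow> jacobian w z \<noteq> 0"
  shows "Ck_on (Suc k) v (w ` S)"
proof -
  have dw: "\<And>z. z \<in> S \<Longrightarrow> w differentiable (at z)" using assms(3) by simp
  let ?J = "\<lambda>z. inverse (jacobian w z)"
  let ?P = "\<lambda>z. ?J z *\<^sub>R Complex (Im (pdy w z)) (- Im (pdx w z))"
  let ?Q = "\<lambda>z. ?J z *\<^sub>R Complex (- Re (pdy w z)) (Re (pdx w z))"
  have v: "v differentiable (at y) \<and> pdx v y = ?P (v y) \<and> pdy v y = ?Q (v y)" if "y \<in> w ` S" for y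
    using that pd_inverse[OF assms(1) dw assms(4) _ assms(5)] assms(4) by fastforce
  have v_in: "v ` (w ` S) \<subseteq> S" using assms(4) by auto
  have PQ: "Ck_on k ?P S" "Ck_on k ?Q S"
  proof -
    have *: "Complex a b = of_real a + \<i> * of_real b" for a b by (simp add: complex_eq_iff)
    have 1: "Ck_on k (pdx w) S" "Ck_on k (pdy w) S" using assms(3) by auto
    note lin = Ck_on_bounded_linear[OF assms(1)]
    note mul = Ck_on_bilinear[OF assms(1) bounded_bilinear_mult]
    have 2: "Ck_on k (\<lambda>z. Re (pdx w z)) S" "Ck_on k (\<lambda>z. Im (pdx w z)) S"
        "Ck_on k (\<lambda>z. Re (pdy w z)) S" "Ck_on k (\<lambda>z. Im (pdy w z)) S"
      by (rule lin[OF bounded_linear_Re 1(1)] lin[OF bounded_linear_Im 1(1)]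
            lin[OF bounded_linear_Re 1(2)] lin[OF bounded_linear_Im 1(2)])+
    have 3: "Ck_on k (\<lambda>z. - f z) S" if "Ck_on k f S" for f :: "complex \<Rightarrow> real"
      by (intro lin[OF bounded_linear_minus[OF bounded_linear_ident]] that)
    have "Ck_on k (\<lambda>z. Re (pdx w z) * Im (pdy w z) + - (Im (pdx w z) * Re (pdy w z))) S"
      by (intro Ck_on_add[OF assms(1)] mul 2 3)
    then have "Ck_on k (jacobian w) S" by (simp add: jacobian_def[abs_def])
    then have J: "Ck_on k ?J S" using assms(1,5) by (intro Ck_on_inverse)
    show "Ck_on k ?P S" "Ck_on k ?Q S"
      unfolding * by (intro Ck_on_bilinear[OF assms(1) bounded_bilinear_scaleR] J Ck_on_add[OF assms(1)] mul
            Ck_on_const[OF assms(1)] lin[OF bounded_linear_of_real] 2 3)+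
  qed
  have cont: "continuous_on (w ` S) v"
    using v by (simp add: continuous_on_if_differentiable)
  have "m \<le> Suc k \<Longrightarrow> Ck_on m v (w ` S)" for m
  proof (induction m)
    case 0 then show ?case using cont by simp
  next
    case (Suc m)
    then have m: "Ck_on m v (w ` S)" by simp
    have "Ck_on m (\<lambda>y. ?P (v y)) (w ` S)" 
      by (rule Ck_on_compose[OF assms(2,1) v_in m Ck_on_le[OF PQ(1)]]) (use Suc.prems in simp)
    moreover have "Ck_on m (\<lambda>y. ?Q (v y)) (w ` S)" 
      by (rule Ck_on_compose[OF assms(2,1) v_in m Ck_on_le[OF PQ(2)]]) (use Suc.prems in simp)
    ultimately show ?case by (intro Ck_on_SucI[OF assms(2) v])
  qed
  then show ?thesis by blast
qed

subsection \<open>Series in z and cnj z\<close>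

text \<open>Differentiating a power series brings in the factor n + 1; a geometric gain q^n absorbs
  it.\<close>

lemma Suc_times_power_bounded:
  fixes q :: real
  assumes "0 \<le> q" "q < 1"
  obtains K where "K \<ge> 0" "\<And>n. of_nat (Suc n) * q ^ n \<le> K"
proof -
  have "(\<lambda>n. of_nat n * q ^ n + q ^ n) \<longlonglongrightarrow> 0 + 0"
    using assms by (intro tendsto_add powser_times_n_limit_0 LIMSEQ_power_zero) auto
  then have "Bseq (\<lambda>n. of_nat n * q ^ n + q ^ n)"
    by (rule convergent_imp_Bseq[OF convergentI])
  then obtain K where K: "K > 0" "\<And>n. norm (of_nat n * q ^ n + q ^ n) \<le> K"
    by (auto simp: Bseq_def)
  show ?thesis
  proof (rule that[of K])
    show "of_nat (Suc n) * q ^ n \<le> K" for n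
      using K(2)[of n] by (simp add: algebra_simps abs_le_iff)
  qed (use K(1) in simp)
qed

text \<open>A stand-in for a holomorphic function of two variables on the bidisc of radius r: it is
  represented by its coefficients with respect to the second variable. Bounds are asked for on every
  smaller bidisc only, so that the class is closed under both derivatives without a change of
  r.\<close>

definition hseries :: "real \<Rightarrow> (nat \<Rightarrow> complex \<Rightarrow> complex) \<Rightarrow> bool" where
  "hseries r a \<longleftrightarrow> (\<forall>n. a n holomorphic_on ball 0 r) \<and>
     (\<forall>s. 0 < s \<longrightarrow> s < r \<longrightarrow> (\<exists>C. \<forall>n. \<forall>z\<in>cball 0 s. cmod (a n z) * s ^ n \<le> C))"

definition diag :: "(nat \<Rightarrow> complex \<Rightarrow> complex) \<Rightarrow> complex \<Rightarrow> complex" where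
  "diag a z = (\<Sum>n. a n z * cnj z ^ n)"

lemma hseries_holomorphic: "hseries r a \<Longrightarrow> a n holomorphic_on ball 0 r"
  by (simp add: hseries_def)

lemma hseries_bound:
  assumes "hseries r a" "0 < s" "s < r"
  obtains C where "C \<ge> 0" "\<And>n z. cmod z \<le> s \<Longrightarrow> cmod (a n z) \<le> C / s ^ n"
proof -
  have "\<exists>C. \<forall>n. \<forall>z\<in>cball 0 s. cmod (a n z) * s ^ n \<le> C"
    using assms by (simp add: hseries_def)
  then obtain C where C: "\<And>n z. z \<in> cball 0 s \<Longrightarrow> cmod (a n z) * s ^ n \<le> C" by blast
  have "0 \<le> cmod (a 0 0)" by simp
  also have "\<dots> \<le> C" using C[of 0 0] assms(2) by simp
  finally show ?thesis
    using C assms(2) by (intro that[of C]) (auto simp: field_simps)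
qed

text \<open>The bound at a radius t strictly between s and r gains the factor (s / t)^n at radius s.
  This gain gives summability, and it pays for the factor n + 1 in
  \<open>hseries_shift\<close>.\<close>

lemma hseries_geometric:
  assumes "hseries r a" "0 < s" "s < r"
  obtains C q where "0 \<le> C" "0 \<le> q" "q < 1" "\<And>n z. cmod z \<le> s \<Longrightarrow> cmod (a n z) * s ^ n \<le> C * q ^ n"
proof -
  define t where "t = (s + r) / 2"
  have t: "s < t" "t < r" "0 < t" using assms by (auto simp: t_def)
  obtain C where C: "C \<ge> 0" "\<And>n z. cmod z \<le> t \<Longrightarrow> cmod (a n z) \<le> C / t ^ n"
    using hseries_bound[OF assms(1) t(3,2)] by blast
  show ?thesis
  proof (rule that[of C "s / t"])
    show "cmod (a n z) * s ^ n \<le> C * (s / t) ^ n" if "cmod z \<le> s" for n z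
      using mult_right_mono[OF C(2)[of z n], of "s ^ n"] that t assms(2) by (simp add: power_divide)
  qed (use C t assms in auto)
qed

text \<open>Cauchy's inequality on discs of radius t - s costs the factor 1 / (t - s), which is the
  same for all n.\<close>

lemma hseries_deriv:
  assumes "hseries r a"
  shows "hseries r (\<lambda>n. deriv (a n))"
  unfolding hseries_def
proof (intro conjI allI impI)
  show "deriv (a n) holomorphic_on ball 0 r" for n
    using hseries_holomorphic[OF assms] by (simp add: holomorphic_deriv)
next
  fix s :: real assume s: "0 < s" "s < r"
  define t where "t = (s + r) / 2"
  have t: "s < t" "t < r" "0 < t" using s by (auto simp: t_def)
  obtain C where C: "C \<ge> 0" "\<And>n z. cmod z \<le> t \<Longrightarrow> cmod (a n z) \<le> C / t ^ n"
    using hseries_bound[OF assms(1) t(3,2)] by blast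
  have "cmod (deriv (a n) z) * s ^ n \<le> C / (t - s)" if z: "z \<in> cball 0 s" for n z
  proof -
    have in_cball: "cmod w \<le> t" if "w \<in> cball z (t - s)" for w
    proof -
      have "cmod w \<le> cmod z + cmod (w - z)" by (metis add.commute norm_triangle_sub)
      then show ?thesis using that z by (simp add: dist_norm norm_minus_commute)
    qed
    have sub: "cball z (t - s) \<subseteq> ball 0 r" using in_cball t by fastforce
    have hol: "a n holomorphic_on cball z (t - s)"
      using hseries_holomorphic[OF assms] sub by (rule holomorphic_on_subset)
    have "cmod ((deriv ^^ 1) (a n) z) \<le> fact 1 * (C / t ^ n) / (t - s) ^ 1"
    proof (rule Cauchy_inequality)
      show "a n holomorphic_on ball z (t - s)"
        using hol ball_subset_cball by (rule holomorphic_on_subset)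
      show "continuous_on (cball z (t - s)) (a n)" using hol by (rule holomorphic_on_imp_continuous_on)
      show "cmod (a n w) \<le> C / t ^ n" if "cmod (z - w) = t - s" for w
        using that in_cball[of w] by (intro C) (simp add: dist_norm)
    qed (use t in simp)
    then have "cmod (deriv (a n) z) * s ^ n \<le> C / t ^ n / (t - s) * s ^ n"
      using s by (intro mult_right_mono) auto
    also have "\<dots> = C / (t - s) * (s / t) ^ n" by (simp add: power_divide)
    also have "\<dots> \<le> C / (t - s) * 1"
      using C t s by (intro mult_left_mono power_le_one) auto
    finally show ?thesis by simp
  qed
  then show "\<exists>C. \<forall>n. \<forall>z\<in>cball 0 s. cmod (deriv (a n) z) * s ^ n \<le> C" by blast
qed

text \<open>The coefficients of the derivative in the second variable \<zeta>.\<close>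

definition shift :: "(nat \<Rightarrow> complex \<Rightarrow> complex) \<Rightarrow> nat \<Rightarrow> complex \<Rightarrow> complex" where
  "shift a n z = of_nat (Suc n) * a (Suc n) z"

lemma hseries_shift:
  assumes "hseries r a"
  shows "hseries r (shift a)"
  unfolding hseries_def
proof (intro conjI allI impI)
  show "shift a n holomorphic_on ball 0 r" for n
    unfolding shift_def[abs_def] by (intro holomorphic_intros hseries_holomorphic[OF assms])
next
  fix s :: real assume s: "0 < s" "s < r"
  obtain C q where C: "0 \<le> C" "0 \<le> q" "q < 1"
      "\<And>n z. cmod z \<le> s \<Longrightarrow> cmod (a n z) * s ^ n \<le> C * q ^ n"
    using hseries_geometric[OF assms s] by blast
  obtain K where K: "K \<ge> 0" "\<And>n. of_nat (Suc n) * q ^ n \<le> K"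
    using Suc_times_power_bounded[OF C(2,3)] by blast
  have "cmod (shift a n z) * s ^ n \<le> C * K / s" if "z \<in> cball 0 s" for n z
  proof -
    have "cmod (shift a n z) * s ^ n = of_nat (Suc n) * (cmod (a (Suc n) z) * s ^ Suc n) / s"
      using s by (simp add: shift_def norm_mult del: of_nat_Suc)
    also have "\<dots> \<le> of_nat (Suc n) * (C * q ^ n) / s"
    proof -
      have "cmod (a (Suc n) z) * s ^ Suc n \<le> C * q ^ Suc n" using C(4)[of z "Suc n"] that by simp
      also have "\<dots> \<le> C * q ^ n" using C by (intro mult_left_mono) (auto simp: mult_left_le_one_le)
      finally show ?thesis using s by (intro divide_right_mono mult_left_mono) auto
    qed
    also have "\<dots> = C * (of_nat (Suc n) * q ^ n) / s" by simp
    also have "\<dots> \<le> C * K / s" using s C K by (intro divide_right_mono mult_left_mono) auto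
    finally show ?thesis .
  qed
  then show "\<exists>C. \<forall>n. \<forall>z\<in>cball 0 s. cmod (shift a n z) * s ^ n \<le> C" by blast
qed

lemma hseries_summable_norm:
  assumes "hseries r a" "z \<in> ball 0 r"
  shows "summable (\<lambda>n. norm (a n z * cnj z ^ n))"
proof -
  obtain s where s: "cmod z < s" "s < r" using assms(2) dense by auto
  then have s0: "0 < s" using norm_ge_zero[of z] by linarith
  obtain C q where C: "0 \<le> C" "0 \<le> q" "q < 1"
      "\<And>n z. cmod z \<le> s \<Longrightarrow> cmod (a n z) * s ^ n \<le> C * q ^ n"
    using hseries_geometric[OF assms(1) s0 s(2)] by blast
  have "norm (norm (a n z * cnj z ^ n)) \<le> C * q ^ n" for n
  proof -
    have "norm (norm (a n z * cnj z ^ n)) \<le> cmod (a n z) * s ^ n"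
      using s by (auto simp: norm_mult norm_power intro!: mult_left_mono power_mono)
    also have "\<dots> \<le> C * q ^ n" using C(4)[of z n] s by simp
    finally show ?thesis .
  qed
  moreover have "summable (\<lambda>n. C * q ^ n)" using C by (intro summable_mult summable_geometric) auto
  ultimately show ?thesis by (rule summable_comparison_test'[rotated])
qed

lemma diag_sums:
  assumes "hseries r a" "z \<in> ball 0 r"
  shows "(\<lambda>n. a n z * cnj z ^ n) sums diag a z"
  unfolding diag_def by (rule summable_sums[OF summable_norm_cancel[OF hseries_summable_norm[OF assms]]])

lemma diag_uniform_limit:
  assumes "hseries r a" "0 < s" "s < r"
  shows "uniform_limit (cball 0 s) (\<lambda>n z. \<Sum>i<n. a i z * cnj z ^ i) (diag a) sequentially"
proof -
  obtain C q where C: "0 \<le> C" "0 \<le> q" "q < 1"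
      "\<And>n z. cmod z \<le> s \<Longrightarrow> cmod (a n z) * s ^ n \<le> C * q ^ n"
    using hseries_geometric[OF assms] by blast
  show ?thesis
    unfolding diag_def[abs_def]
  proof (rule Weierstrass_m_test)
    show "summable (\<lambda>n. C * q ^ n)" using C by (intro summable_mult summable_geometric) auto
    fix n z assume z: "z \<in> cball (0::complex) s"
    have "norm (a n z * cnj z ^ n) \<le> cmod (a n z) * s ^ n"
      using z by (auto simp: norm_mult norm_power intro!: mult_left_mono power_mono)
    also have "\<dots> \<le> C * q ^ n" using C(4)[of z n] z by simp
    finally show "norm (a n z * cnj z ^ n) \<le> C * q ^ n" .
  qed
qed

text \<open>The chain rule for a function of (z, \<zeta>) on \<zeta> = cnj z: the derivative in z
  contributes the complex linear part, the derivative in \<zeta> the antilinear part. It is proved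
  by differentiating term by term, with uniform convergence of the two differentiated
  series.\<close>

lemma diag_has_derivative:
  assumes a: "hseries r a" and z: "z \<in> ball 0 r"
  shows "(diag a has_derivative
    (\<lambda>h. diag (\<lambda>n. deriv (a n)) z * h + diag (shift a) z * cnj h)) (at z)"
proof -
  obtain s where s: "cmod z < s" "s < r" using z dense by auto
  then have s0: "0 < s" using norm_ge_zero[of z] by linarith
  let ?A = "diag (\<lambda>n. deriv (a n))" and ?B = "diag (shift a)"
  let ?d = "\<lambda>n w h. deriv (a n) w * h * cnj w ^ n + a n w * (of_nat n * (cnj h * cnj w ^ (n - 1)))"
  have part: "((\<lambda>w. a n w * cnj w ^ n) has_derivative ?d n w) (at w within ball 0 s)" if "w \<in> ball 0 s" for n w
  proof -
    have "w \<in> ball 0 r" using that s by auto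
    then have "(a n has_field_derivative deriv (a n) w) (at w)"
      using hseries_holomorphic[OF a] by (intro holomorphic_derivI) auto
    then have 1: "(a n has_derivative (\<lambda>h. deriv (a n) w * h)) (at w)"
      by (simp add: has_field_derivative_def)
    have "((\<lambda>w. a n w * cnj w ^ n) has_derivative ?d n w) (at w)"
      by (rule has_derivative_eq_rhs[OF has_derivative_mult[OF 1 has_derivative_power[OF has_derivative_cnj[OF has_derivative_ident]]]])
        (simp add: fun_eq_iff)
    then show ?thesis by (rule has_derivative_at_withinI)
  qed
  have unif: "\<forall>\<^sub>F n in sequentially. \<forall>w\<in>ball 0 s. \<forall>h.
        norm (sum (\<lambda>i. ?d i w h) {..<n} - (?A w * h + ?B w * cnj h)) \<le> e * norm h" if "e > 0" for e
  proof -
    have "\<forall>\<^sub>F n in sequentially. \<forall>w\<in>cball 0 s. dist (\<Sum>i<n. deriv (a i) w * cnj w ^ i) (?A w) < e/2"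
      using diag_uniform_limit[OF hseries_deriv[OF a] s0 s(2), unfolded uniform_limit_iff, rule_format, of "e/2"] that
      by simp
    \<comment> \<open>Differentiation in \<zeta> kills the term of index 0, so n + 1 terms of the
      original series go with n + 1 terms of the z-derivative but only n terms of the
      \<open>shift\<close> series. The index is moved here to match.\<close>
    then have "\<forall>\<^sub>F n in sequentially. \<forall>w\<in>cball 0 s. dist (\<Sum>i<Suc n. deriv (a i) w * cnj w ^ i) (?A w) < e/2"
      by (subst eventually_sequentially_Suc)
    moreover have "\<forall>\<^sub>F n in sequentially. \<forall>w\<in>cball 0 s. dist (\<Sum>i<n. shift a i w * cnj w ^ i) (?B w) < e/2"
      using diag_uniform_limit[OF hseries_shift[OF a] s0 s(2), unfolded uniform_limit_iff, rule_format, of "e/2"] that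
      by simp
    ultimately have "\<forall>\<^sub>F n in sequentially. \<forall>w\<in>ball 0 s. \<forall>h.
        norm (sum (\<lambda>i. ?d i w h) {..<Suc n} - (?A w * h + ?B w * cnj h)) \<le> e * norm h"
    proof eventually_elim
      case (elim n)
      show ?case
      proof (intro ballI allI)
        fix w h assume "w \<in> ball (0::complex) s"
        then have w: "w \<in> cball 0 s" by simp
        let ?P = "(\<Sum>i<Suc n. deriv (a i) w * cnj w ^ i)" and ?Q = "(\<Sum>i<n. shift a i w * cnj w ^ i)"
        have Q: "(\<Sum>i<Suc n. a i w * (of_nat i * (cnj h * cnj w ^ (i - 1)))) = ?Q * cnj h"
          unfolding sum.lessThan_Suc_shift sum_distrib_right
          by (simp add: shift_def mult_ac del: of_nat_Suc)
        have P: "(\<Sum>i<Suc n. deriv (a i) w * h * cnj w ^ i) = ?P * h"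
          unfolding sum_distrib_right by (rule sum.cong) (simp_all add: mult_ac)
        have "norm (sum (\<lambda>i. ?d i w h) {..<Suc n} - (?A w * h + ?B w * cnj h))
            = norm ((?P - ?A w) * h + (?Q - ?B w) * cnj h)"
          unfolding sum.distrib P Q by (simp add: algebra_simps)
        also have "\<dots> \<le> norm (?P - ?A w) * norm h + norm (?Q - ?B w) * norm h"
          by (rule order.trans[OF norm_triangle_ineq]) (simp add: norm_mult)
        also have "\<dots> \<le> e/2 * norm h + e/2 * norm h"
          using elim w by (intro add_mono mult_right_mono) (auto simp: dist_norm intro: less_imp_le)
        finally show "norm (sum (\<lambda>i. ?d i w h) {..<Suc n} - (?A w * h + ?B w * cnj h)) \<le> e * norm h" by simp
      qed
    qed
    then show ?thesis by (subst (asm) eventually_sequentially_Suc)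
  qed
  have "\<exists>g. \<forall>w\<in>ball 0 s. (\<lambda>n. a n w * cnj w ^ n) sums g w \<and>
      (g has_derivative (\<lambda>h. ?A w * h + ?B w * cnj h)) (at w within ball 0 s)"
    by (rule has_derivative_series[OF convex_ball part unif _ diag_sums[OF a z]]) (use s in auto)
  then obtain g where g: "\<And>w. w \<in> ball 0 s \<Longrightarrow> (\<lambda>n. a n w * cnj w ^ n) sums g w \<and>
      (g has_derivative (\<lambda>h. ?A w * h + ?B w * cnj h)) (at w within ball 0 s)"
    by blast
  have "g w = diag a w" if "w \<in> ball 0 s" for w
    using g[OF that] diag_sums[OF a, of w] that s sums_unique2 by fastforce
  moreover have "(g has_derivative (\<lambda>h. ?A z * h + ?B z * cnj h)) (at z)"
    using g[of z] s by (simp add: at_within_open[of z "ball 0 s"])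
  ultimately show ?thesis
    using s by (auto intro: has_derivative_transform_within_open[of _ _ _ _ "ball 0 s"])
qed

lemma diag_pd:
  assumes "hseries r a" "z \<in> ball 0 r"
  shows "diag a differentiable (at z) \<and>
    pdx (diag a) z = diag (\<lambda>n. deriv (a n)) z + diag (shift a) z \<and>
    pdy (diag a) z = \<i> * diag (\<lambda>n. deriv (a n)) z + (- \<i>) * diag (shift a) z"
proof (rule has_derivative_pdI[OF diag_has_derivative[OF assms]])
  fix h
  have "h = of_real (Re h) + \<i> * of_real (Im h)" "cnj h = of_real (Re h) - \<i> * of_real (Im h)"
    by (simp_all add: complex_eq_iff)
  then show "diag (\<lambda>n. deriv (a n)) z * h + diag (shift a) z * cnj h =
     Re h *\<^sub>R (diag (\<lambda>n. deriv (a n)) z + diag (shift a) z) +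
     Im h *\<^sub>R (\<i> * diag (\<lambda>n. deriv (a n)) z + (- \<i>) * diag (shift a) z)"
    unfolding scaleR_conv_of_real by algebra
qed

text \<open>With \<zeta> = cnj z, the partial derivatives in x and y are linear combinations of the
  diagonals of the z- and \<zeta>-derivatives. Both belong to the same class of series, so the
  induction runs over all of them at once.\<close>

lemma Ck_on_diag: "hseries r a \<Longrightarrow> Ck_on k (diag a) (ball 0 r)"
proof (induction k arbitrary: a)
  case 0
  then show ?case using diag_pd by (auto intro: continuous_on_if_differentiable)
next
  case (Suc k)
  note 1 = Suc.IH[OF hseries_deriv[OF Suc.prems]] and 2 = Suc.IH[OF hseries_shift[OF Suc.prems]]
  note mul = Ck_on_bounded_linear[OF open_ball bounded_linear_mult_right]
  show ?case
    by (rule Ck_on_SucI[OF open_ball diag_pd[OF Suc.prems] Ck_on_add[OF open_ball 1 2]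
          Ck_on_add[OF open_ball mul[OF 1] mul[OF 2]]])
qed

subsection \<open>The Beltrami equation with analytic coefficient\<close>

definition coeff2 :: "(complex \<Rightarrow> complex \<Rightarrow> complex) \<Rightarrow> nat \<Rightarrow> complex \<Rightarrow> complex" where
  "coeff2 G k z = (deriv ^^ k) (G z) 0 / fact k"

context
  fixes G :: "complex \<Rightarrow> complex \<Rightarrow> complex" and r M :: real
  assumes r: "0 < r"
    and hol1: "\<And>\<zeta>. \<zeta> \<in> ball 0 r \<Longrightarrow> (\<lambda>z. G z \<zeta>) holomorphic_on ball 0 r"
    and hol2: "\<And>z. z \<in> ball 0 r \<Longrightarrow> G z holomorphic_on ball 0 r"
    and bound: "\<And>z \<zeta>. z \<in> ball 0 r \<Longrightarrow> \<zeta> \<in> ball 0 r \<Longrightarrow> cmod (G z \<zeta>) \<le> M"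
begin

lemma coeff2_sums:
  assumes "z \<in> ball 0 r" "\<zeta> \<in> ball 0 r"
  shows "(\<lambda>k. coeff2 G k z * \<zeta> ^ k) sums G z \<zeta>"
  using holomorphic_power_series[OF hol2[OF assms(1)] assms(2)] by (simp add: coeff2_def)

text \<open>Cauchy's inequality on the circle of radius r/2, which lies inside the open disc where G
  is known; this is the origin of the ratio 2/r.\<close>

lemma coeff2_bound:
  assumes "z \<in> ball 0 r"
  shows "cmod (coeff2 G k z) \<le> M * (2 / r) ^ k"
proof -
  have sub: "cball 0 (r/2) \<subseteq> ball (0::complex) r" "ball 0 (r/2) \<subseteq> ball (0::complex) r"
    using r by auto
  have "cmod ((deriv ^^ k) (G z) 0) \<le> fact k * M / (r/2) ^ k"
  proof (rule Cauchy_inequality)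
    show "G z holomorphic_on ball 0 (r/2)" by (rule holomorphic_on_subset[OF hol2[OF assms] sub(2)])
    show "continuous_on (cball 0 (r/2)) (G z)"
      by (rule holomorphic_on_imp_continuous_on[OF holomorphic_on_subset[OF hol2[OF assms] sub(1)]])
    show "cmod (G z x) \<le> M" if "cmod (0 - x) = r / 2" for x
      using that r by (intro bound[OF assms]) simp
  qed (use r in simp)
  then show ?thesis by (simp add: coeff2_def norm_divide field_simps)
qed

text \<open>Remove the first k terms of the expansion in \<zeta> and divide by \<zeta>^k: as \<zeta>
  tends to 0 this tends to the k-th coefficient, uniformly in z. For fixed \<zeta> the quotient is
  holomorphic in z, by induction on k. Separate holomorphy together with the bound on G is thus
  enough.\<close>

lemma coeff2_holomorphic: "coeff2 G k holomorphic_on ball 0 r"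
proof (induction k rule: less_induct)
  case (less k)
  \<comment> \<open>A null sequence chosen so that the terms after the k-th are dominated by a
    geometric series of ratio 1 / (2 (n + 1)) \<le> 1/2. Its sum is at most twice the first term,
    which gives the error \<open>?D / (n + 1)\<close>.\<close>
  define \<zeta> where "\<zeta> n = complex_of_real (r / (4 * real (Suc n)))" for n
  have \<zeta>: "\<zeta> n \<noteq> 0" "\<zeta> n \<in> ball 0 r" "2 / r * cmod (\<zeta> n) = 1 / (2 * real (Suc n))" for n
    using r by (auto simp: \<zeta>_def norm_divide norm_mult field_simps simp del: of_nat_Suc intro: less_le_trans[of 1 4])
  let ?f = "\<lambda>n z. (G z (\<zeta> n) - (\<Sum>j<k. coeff2 G j z * \<zeta> n ^ j)) / \<zeta> n ^ k"
  let ?D = "M * (2 / r) ^ k"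
  have err: "cmod (?f n z - coeff2 G k z) \<le> ?D / real (Suc n)" if z: "z \<in> ball 0 r" for n z
  proof -
    let ?x = "1 / (2 * real (Suc n))"
    have x: "0 \<le> ?x" "?x < 1" "?x \<le> 1/2" by (auto simp: field_simps)
    have D: "0 \<le> ?D" using coeff2_bound[OF z, of k] norm_ge_zero order.trans by blast
    have "(\<lambda>i. coeff2 G (i + k) z * \<zeta> n ^ (i + k)) sums (G z (\<zeta> n) - (\<Sum>j<k. coeff2 G j z * \<zeta> n ^ j))"
      using sums_split_initial_segment[OF coeff2_sums[OF z \<zeta>(2)]] by simp
    then have "(\<lambda>i. coeff2 G (i + k) z * \<zeta> n ^ (i + k) / \<zeta> n ^ k) sums ?f n z"
      by (rule sums_divide)
    then have "(\<lambda>i. coeff2 G (i + k) z * \<zeta> n ^ i) sums ?f n z"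
      using \<zeta>(1) by (simp add: power_add)
    then have s: "(\<lambda>i. coeff2 G (Suc i + k) z * \<zeta> n ^ Suc i) sums (?f n z - coeff2 G k z)"
      by (subst sums_Suc_iff) simp
    have le: "cmod (coeff2 G (Suc i + k) z * \<zeta> n ^ Suc i) \<le> ?D * ?x * ?x ^ i" for i
    proof -
      have "cmod (coeff2 G (Suc i + k) z * \<zeta> n ^ Suc i) \<le> M * (2 / r) ^ (Suc i + k) * cmod (\<zeta> n) ^ Suc i"
        unfolding norm_mult norm_power by (intro mult_right_mono coeff2_bound[OF z]) simp
      also have "\<dots> = ?D * (2 / r * cmod (\<zeta> n)) ^ Suc i"
        by (simp only: power_add power_mult_distrib mult_ac)
      finally show ?thesis unfolding \<zeta>(3) by (simp only: power_Suc mult_ac)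
    qed
    have geo: "(\<lambda>i. ?D * ?x * ?x ^ i) sums (?D * ?x * (1 / (1 - ?x)))"
      using x by (intro sums_mult geometric_sums) auto
    have "cmod (?f n z - coeff2 G k z) \<le> ?D * ?x * (1 / (1 - ?x))"
      unfolding sums_unique[OF s] sums_unique[OF geo]
      by (rule norm_suminf_le[OF le sums_summable[OF geo]])
    also have "\<dots> \<le> ?D * ?x * 2"
      using x by (intro mult_left_mono[OF _ mult_nonneg_nonneg[OF D x(1)]]) (auto simp: field_simps)
    also have "\<dots> = ?D / real (Suc n)" by (simp del: of_nat_Suc)
    finally show ?thesis .
  qed
  have unif: "uniform_limit (ball 0 r) ?f (coeff2 G k) sequentially"
  proof (rule uniform_limitI)
    fix e :: real assume "e > 0"
    have "(\<lambda>n. ?D * inverse (real (Suc n))) \<longlonglongrightarrow> ?D * 0"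
      by (intro tendsto_intros LIMSEQ_inverse_real_of_nat)
    then have "\<forall>\<^sub>F n in sequentially. ?D * inverse (real (Suc n)) < e"
      using \<open>e > 0\<close> by (intro order_tendstoD) auto
    then show "\<forall>\<^sub>F n in sequentially. \<forall>z\<in>ball 0 r. dist (?f n z) (coeff2 G k z) < e"
    proof eventually_elim
      case (elim n)
      show ?case
      proof
        fix z assume "z \<in> ball (0::complex) r"
        from err[OF this, of n] elim show "dist (?f n z) (coeff2 G k z) < e"
          by (simp only: dist_norm divide_inverse)
      qed
    qed
  qed
  show ?case
  proof (rule holomorphic_uniform_sequence[OF open_ball])
    show "?f n holomorphic_on ball 0 r" for n
      using less \<zeta> by (intro holomorphic_intros hol1) auto
    show "\<exists>d>0. cball x d \<subseteq> ball 0 r \<and> uniform_limit (cball x d) ?f (coeff2 G k) sequentially"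
      if "x \<in> ball 0 r" for x
    proof -
      obtain d where "d > 0" "cball x d \<subseteq> ball 0 r"
        using \<open>x \<in> ball 0 r\<close> open_contains_cball_eq[OF open_ball] by blast
      then show ?thesis using uniform_limit_on_subset[OF unif] by blast
    qed
  qed
qed

end

text \<open>Applying Cauchy's inequality on the disc of radius \<open>(R - cmod z) / (m + 2)\<close> makes the loss linear
  in \<open>m\<close>; the denominator \<open>n + 1\<close> in \<open>beltrami_coeff\<close> below absorbs it.\<close>

lemma Cauchy_bound_deriv_boundary_distance:
  assumes f: "f holomorphic_on ball 0 R"
    and bound: "\<And>z. z \<in> ball 0 R \<Longrightarrow> cmod (f z) \<le> A / (R - cmod z) ^ m"
    and z: "z \<in> ball 0 R"
  shows "cmod (deriv f z) \<le> 6 * real (Suc m) * A / (R - cmod z) ^ Suc m"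
proof -
  define d where "d = R - cmod z"
  have d: "d > 0" using z by (simp add: d_def)
  have A: "A \<ge> 0"
  proof -
    have "0 \<le> A / d ^ m" using bound[OF z] norm_ge_zero order.trans unfolding d_def by blast
    then show ?thesis using zero_less_power[OF d, of m] by (auto simp: zero_le_divide_iff)
  qed
  let ?k = "real m + 2"
  define \<rho> where "\<rho> = d / ?k"
  have \<rho>: "\<rho> > 0" "\<rho> < d" using d by (auto simp: \<rho>_def field_simps intro: add_pos_nonneg)
  \<comment> \<open>Moving by \<open>\<rho>\<close> shortens the distance to the boundary at most by
    the factor (m + 1) / (m + 2), whose m-th power stays bounded away from 0.\<close>
  have far: "d * ((real m + 1) / ?k) \<le> R - cmod w" if "w \<in> cball z \<rho>" for w
  proof -
    have "cmod w \<le> cmod z + cmod (w - z)" by (metis add.commute norm_triangle_sub)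
    then have "d - \<rho> \<le> R - cmod w" using that by (simp add: dist_norm norm_minus_commute d_def)
    moreover have "d - \<rho> = d * ((real m + 1) / ?k)" by (simp add: \<rho>_def field_simps)
    ultimately show ?thesis by simp
  qed
  have pos: "0 < d * ((real m + 1) / ?k)" using d by (intro mult_pos_pos divide_pos_pos) auto
  have sub: "cball z \<rho> \<subseteq> ball 0 R" using far pos by fastforce
  have hol: "f holomorphic_on cball z \<rho>" using f sub by (rule holomorphic_on_subset)
  let ?B = "A / (d * ((real m + 1) / ?k)) ^ m"
  have "cmod ((deriv ^^ 1) f z) \<le> fact 1 * ?B / \<rho> ^ 1"
  proof (rule Cauchy_inequality)
    show "f holomorphic_on ball z \<rho>" using hol ball_subset_cball by (rule holomorphic_on_subset)
    show "continuous_on (cball z \<rho>) f" using hol by (rule holomorphic_on_imp_continuous_on)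
    show "cmod (f w) \<le> ?B" if "cmod (z - w) = \<rho>" for w
    proof -
      have w: "w \<in> cball z \<rho>" using that by (simp add: dist_norm)
      have "cmod (f w) \<le> A / (R - cmod w) ^ m" using w sub by (intro bound) auto
      also have "\<dots> \<le> ?B"
        using pos far[OF w] less_le_trans[OF pos far[OF w]] A d by (intro divide_left_mono power_mono mult_pos_pos zero_less_power) auto
      finally show ?thesis .
    qed
  qed (use \<rho> in simp)
  also have "fact 1 * ?B / \<rho> ^ 1 = ?k * (?k / (real m + 1)) ^ m * A / d ^ Suc m"
  proof -
    have "(d * ((real m + 1) / ?k)) ^ m = d ^ m / (?k / (real m + 1)) ^ m"
      by (simp add: power_mult_distrib power_divide)
    then show ?thesis by (simp add: \<rho>_def mult_ac)
  qed
  also have "\<dots> \<le> (6 * real (Suc m)) * A / d ^ Suc m"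
  proof -
    \<comment> \<open>The constant 6 is 2 * 3: m + 2 is at most 2 (m + 1), and (1 + 1 / (m + 1))^m
      is at most e, hence at most 3.\<close>
    have "(?k / (real m + 1)) ^ m = (1 + 1 / (real m + 1)) ^ m" by (simp add: field_simps)
    also have "\<dots> \<le> exp (1 / (real m + 1)) ^ m"
      by (intro power_mono exp_ge_add_one_self) simp
    also have "\<dots> = exp (real m / (real m + 1))" by (simp add: exp_of_nat_mult[symmetric])
    also have "\<dots> \<le> exp 1" by (simp add: field_simps)
    also have "\<dots> \<le> 3" by (rule exp_le)
    finally have "?k * (?k / (real m + 1)) ^ m \<le> (2 * real (Suc m)) * 3"
      by (intro mult_mono) auto
    then show ?thesis using A d by (intro divide_right_mono mult_right_mono) auto
  qed
  finally show ?thesis by (simp add: d_def)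
qed

text \<open>The coefficients of \<open>\<zeta>\<^sup>n\<close> in the solution of \<open>w\<^sub>\<zeta> = \<mu> w\<^sub>z\<close>, \<open>w(z, 0) = z\<close>, where \<open>\<mu> k\<close> is the
  coefficient of \<open>\<zeta>\<^sup>k\<close> in \<open>\<mu>\<close>.\<close>

fun beltrami_coeff :: "(nat \<Rightarrow> complex \<Rightarrow> complex) \<Rightarrow> nat \<Rightarrow> complex \<Rightarrow> complex" where
  "beltrami_coeff \<mu> 0 = (\<lambda>z. z)"
| "beltrami_coeff \<mu> (Suc n) =
     (\<lambda>z. (\<Sum>k\<le>n. \<mu> k z * deriv (beltrami_coeff \<mu> (n - k)) z) / of_nat (Suc n))"

text \<open>Measuring by powers of the distance R - |z| to the boundary lets every step work on the
  full disc: one derivative raises the exponent by one, exactly as the index rises. The condition L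
  \<ge> 2 K turns the convolution with \<open>\<mu>\<close> into a geometric sum of ratio 1/2,
  bounded by 2. With the factor 6 from Cauchy's inequality this leaves 12 M, which L also
  dominates.\<close>

lemma beltrami_coeff_bound:
  assumes R: "0 < R" "R \<le> 1" and K: "K > 0" and M: "M \<ge> 0"
    and hol: "\<And>k. \<mu> k holomorphic_on ball 0 R"
    and bound: "\<And>k z. z \<in> ball 0 R \<Longrightarrow> cmod (\<mu> k z) \<le> M * K ^ k"
    and L: "L \<ge> 2 * K" "L \<ge> 12 * M" 
  shows "beltrami_coeff \<mu> n holomorphic_on ball 0 R \<and>
    (\<forall>z\<in>ball 0 R. cmod (beltrami_coeff \<mu> n z) \<le> L ^ n / (R - cmod z) ^ n)"
proof (induction n rule: less_induct)
  case (less n)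
  have L0: "L > 0" using K L by simp
  show ?case
  proof (cases n)
    case 0
    then show ?thesis using R by (auto intro: holomorphic_intros)
  next
    case (Suc m)
    let ?a = "beltrami_coeff \<mu>"
    have hol': "deriv (?a (m - k)) holomorphic_on ball 0 R" for k
      using less[of "m - k"] Suc by (intro holomorphic_deriv) auto
    have "?a (Suc m) holomorphic_on ball 0 R"
      unfolding beltrami_coeff.simps by (intro holomorphic_intros hol hol') (simp del: of_nat_Suc)
    moreover have "cmod (?a (Suc m) z) \<le> L ^ Suc m / (R - cmod z) ^ Suc m" if z: "z \<in> ball 0 R" for z
    proof -
      let ?d = "R - cmod z"
      have d: "0 < ?d" "?d \<le> 1" using z R by (auto intro: order.trans[of _ R])
      have summand: "cmod (\<mu> k z * deriv (?a (m - k)) z) \<le> 6 * real (Suc m) * M * L ^ m / ?d ^ Suc m * (1/2) ^ k"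
        if k: "k \<le> m" for k
      proof -
        have "cmod (deriv (?a (m - k)) z) \<le> 6 * real (Suc (m - k)) * L ^ (m - k) / ?d ^ Suc (m - k)"
          using less[of "m - k"] Suc by (intro Cauchy_bound_deriv_boundary_distance[OF _ _ z]) auto
        \<comment> \<open>Here R \<le> 1 enters: the distance is at most 1, so all summands can be
          brought to the same power \<open>Suc m\<close> of it.\<close>
        also have "\<dots> \<le> 6 * real (Suc m) * L ^ (m - k) / ?d ^ Suc m"
          using d L0 by (intro frac_le mult_right_mono power_decreasing) auto
        finally have "cmod (\<mu> k z * deriv (?a (m - k)) z)
            \<le> (M * K ^ k) * (6 * real (Suc m) * L ^ (m - k) / ?d ^ Suc m)"
          unfolding norm_mult using bound[OF z] M K by (intro mult_mono) auto
        also have "\<dots> \<le> (M * (L / 2) ^ k) * (6 * real (Suc m) * L ^ (m - k) / ?d ^ Suc m)"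
          using M K L d L0 by (intro mult_right_mono mult_left_mono power_mono) auto
        also have "\<dots> = 6 * real (Suc m) * M * (L ^ k * L ^ (m - k)) / ?d ^ Suc m * (1/2) ^ k"
          by (simp add: power_divide mult_ac)
        also have "L ^ k * L ^ (m - k) = L ^ m" using k by (simp add: power_add[symmetric])
        finally show ?thesis .
      qed
      have "cmod (\<Sum>k\<le>m. \<mu> k z * deriv (?a (m - k)) z)
          \<le> (\<Sum>k\<le>m. 6 * real (Suc m) * M * L ^ m / ?d ^ Suc m * (1/2) ^ k)"
        by (intro sum_norm_le summand) simp
      also have "\<dots> = 6 * real (Suc m) * M * L ^ m / ?d ^ Suc m * (\<Sum>k\<le>m. (1/2) ^ k)"
        by (simp only: sum_distrib_left)
      also have "\<dots> \<le> 6 * real (Suc m) * M * L ^ m / ?d ^ Suc m * 2"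
        using M L0 d by (intro mult_left_mono) (auto simp: sum_gp0)
      also have "\<dots> = real (Suc m) * ((12 * M) * L ^ m) / ?d ^ Suc m" by simp
      also have "\<dots> \<le> real (Suc m) * (L * L ^ m) / ?d ^ Suc m"
        using L L0 d by (intro divide_right_mono mult_left_mono mult_right_mono) auto
      finally show ?thesis
        by (simp add: norm_divide divide_le_eq mult_ac del: of_nat_Suc)
    qed
    ultimately show ?thesis unfolding Suc by blast
  qed
qed

text \<open>For |z| \<le> t < s the distance R - |z| is at least R/2, and t L \<le> s L \<le> R/2.
  Hence t L / (R - |z|) \<le> 1, so the weighted coefficients stay bounded. The same choice gives t
  K \<le> 1, which handles \<open>\<mu>\<close>.\<close>

lemma hseries_beltrami_coeff:
  assumes R: "0 < R" "R \<le> 1" and K: "K > 0" and M: "M \<ge> 0"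
    and hol: "\<And>k. \<mu> k holomorphic_on ball 0 R"
    and bound: "\<And>k z. z \<in> ball 0 R \<Longrightarrow> cmod (\<mu> k z) \<le> M * K ^ k"
    and L: "L \<ge> 2 * K" "L \<ge> 12 * M" and s: "s \<le> R / 2" "s * L \<le> R / 2"
  shows "hseries s (beltrami_coeff \<mu>)" "hseries s \<mu>"
proof -
  have L0: "L > 0" using K L by simp
  have sub: "ball 0 s \<subseteq> ball (0::complex) R" using s R by auto
  note bc = beltrami_coeff_bound[OF R K M hol bound L]
  have 1: "cmod (beltrami_coeff \<mu> n z) * t ^ n \<le> 1" if "0 < t" "t < s" "z \<in> cball 0 t" for t n z
  proof -
    have z: "z \<in> ball 0 R" "cmod z \<le> t" using that s R by auto
    have "t * L \<le> s * L" using that L0 by (intro mult_right_mono) auto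
    also have "\<dots> \<le> R - cmod z" using s z that by linarith
    finally have "L * t \<le> R - cmod z" by (simp add: mult.commute)
    then have "(L * t / (R - cmod z)) ^ n \<le> 1" using L0 that z by (intro power_le_one) auto
    moreover have "cmod (beltrami_coeff \<mu> n z) * t ^ n \<le> L ^ n / (R - cmod z) ^ n * t ^ n"
      using bc[of n] z that by (intro mult_right_mono) auto
    ultimately show ?thesis by (simp add: power_mult_distrib power_divide)
  qed
  have 2: "cmod (\<mu> n z) * t ^ n \<le> M" if "0 < t" "t < s" "z \<in> cball 0 t" for t n z
  proof -
    have z: "z \<in> ball 0 R" using that s R by auto
    have "t * (2 * K) \<le> s * L" using that L0 L K by (intro mult_mono) auto
    then have "2 * (K * t) \<le> s * L" by (simp add: mult_ac)
    then have "K * t \<le> 1" using s R by linarith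
    then have "(K * t) ^ n \<le> 1" using K that by (intro power_le_one) auto
    then have "M * (K * t) ^ n \<le> M * 1" using M by (rule mult_left_mono)
    moreover have "cmod (\<mu> n z) * t ^ n \<le> M * K ^ n * t ^ n"
      using bound[OF z, of n] that by (intro mult_right_mono) auto
    ultimately show ?thesis by (simp add: power_mult_distrib)
  qed
  show "hseries s (beltrami_coeff \<mu>)"
    unfolding hseries_def
  proof (intro conjI allI impI)
    show "beltrami_coeff \<mu> n holomorphic_on ball 0 s" for n
      using bc[of n] sub holomorphic_on_subset by blast
    show "\<exists>C. \<forall>n. \<forall>z\<in>cball 0 t. cmod (beltrami_coeff \<mu> n z) * t ^ n \<le> C" if "0 < t" "t < s" for t
      using 1[OF that] by blast
  qed
  show "hseries s \<mu>"
    unfolding hseries_def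
  proof (intro conjI allI impI)
    show "\<mu> n holomorphic_on ball 0 s" for n
      using hol sub by (rule holomorphic_on_subset)
    show "\<exists>C. \<forall>n. \<forall>z\<in>cball 0 t. cmod (\<mu> n z) * t ^ n \<le> C" if "0 < t" "t < s" for t
      using 2[OF that] by blast
  qed
qed

section \<open>Summing the formal solution of the Beltrami equation\<close>

lemma diag_at_0: "diag a 0 = a 0 0"
  unfolding diag_def by (subst suminf_finite[of "{0}"]) auto

text \<open>The recursion for \<open>beltrami_coeff\<close> is the comparison of coefficients in the
  Beltrami equation; the Cauchy product turns it back into an equation between the sums.\<close>

lemma diag_shift_beltrami_coeff:
  assumes "hseries s (beltrami_coeff \<mu>)" "hseries s \<mu>" "z \<in> ball 0 s"
  shows "diag (shift (beltrami_coeff \<mu>)) z = diag \<mu> z * diag (\<lambda>n. deriv (beltrami_coeff \<mu> n)) z"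
proof -
  have "(\<Sum>i\<le>n. (\<mu> i z * cnj z ^ i) * (deriv (beltrami_coeff \<mu> (n - i)) z * cnj z ^ (n - i)))
      = shift (beltrami_coeff \<mu>) n z * cnj z ^ n" for n
  proof -
    have "(\<mu> i z * cnj z ^ i) * (deriv (beltrami_coeff \<mu> (n - i)) z * cnj z ^ (n - i))
       = \<mu> i z * deriv (beltrami_coeff \<mu> (n - i)) z * cnj z ^ n" if "i \<le> n" for i
      using that by (simp add: mult_ac power_add[symmetric])
    then have "(\<Sum>i\<le>n. (\<mu> i z * cnj z ^ i) * (deriv (beltrami_coeff \<mu> (n - i)) z * cnj z ^ (n - i)))
        = (\<Sum>i\<le>n. \<mu> i z * deriv (beltrami_coeff \<mu> (n - i)) z * cnj z ^ n)"
      by (intro sum.cong) auto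
    then show ?thesis
      by (simp add: shift_def sum_distrib_right del: of_nat_Suc)
  qed
  then show ?thesis
    using Cauchy_product[OF hseries_summable_norm[OF assms(2,3)] hseries_summable_norm[OF hseries_deriv[OF assms(1)] assms(3)]]
    by (simp add: diag_def)
qed

text \<open>A is the Wirtinger derivative w_z, and the derivative of w with respect to cnj z is A
  times G. The partial derivatives are stated as w_x = w_z + w_(cnj z) and w_y = \<i> (w_z - w_(cnj
  z)).\<close>

proposition beltrami_equation_local_solution:
  fixes G :: "complex \<Rightarrow> complex \<Rightarrow> complex" and r M :: real
  assumes r: "0 < r"
    and hol1: "\<And>\<zeta>. \<zeta> \<in> ball 0 r \<Longrightarrow> (\<lambda>z. G z \<zeta>) holomorphic_on ball 0 r"
    and hol2: "\<And>z. z \<in> ball 0 r \<Longrightarrow> G z holomorphic_on ball 0 r"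
    and bound: "\<And>z \<zeta>. z \<in> ball 0 r \<Longrightarrow> \<zeta> \<in> ball 0 r \<Longrightarrow> cmod (G z \<zeta>) \<le> M"
  obtains s w A where "0 < s" "s \<le> r" "\<And>k. Ck_on k w (ball 0 s)"
    and "\<And>z. z \<in> ball 0 s \<Longrightarrow> A z \<noteq> 0"
    and "\<And>z. z \<in> ball 0 s \<Longrightarrow> pdx w z = A z * (1 + G z (cnj z))"
    and "\<And>z. z \<in> ball 0 s \<Longrightarrow> pdy w z = \<i> * A z * (1 - G z (cnj z))"
proof -
  define R where "R = min r 1"
  have R: "0 < R" "R \<le> 1" "R \<le> r" using r by (auto simp: R_def)
  define K where "K = 2 / r"
  have K: "K > 0" using r by (simp add: K_def)
  have M: "M \<ge> 0" using order.trans[OF norm_ge_zero bound[of 0 0]] r by simp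
  define L where "L = 2 * K + 12 * M"
  have L: "L \<ge> 2 * K" "L \<ge> 12 * M" "L > 0" using K M by (auto simp: L_def)
  define s where "s = min (R / 2) (R / (2 * L))"
  have s: "0 < s" "s \<le> R / 2" using R L by (auto simp: s_def)
  have sL: "s * L \<le> R / 2"
  proof -
    have "s * L \<le> R / (2 * L) * L" using L by (intro mult_right_mono) (auto simp: s_def)
    then show ?thesis using L by simp
  qed
  define \<mu> where "\<mu> = coeff2 G"
  define a where "a = beltrami_coeff \<mu>"
  note G = r hol1 hol2 bound
  have sub: "ball 0 R \<subseteq> ball (0::complex) r" using R by auto
  have \<mu>: "\<mu> k holomorphic_on ball 0 R" for k
    unfolding \<mu>_def using coeff2_holomorphic[OF G] sub by (rule holomorphic_on_subset) auto
  have \<mu>_bound: "cmod (\<mu> k z) \<le> M * K ^ k" if "z \<in> ball 0 R" for k z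
    unfolding \<mu>_def K_def by (rule coeff2_bound[OF G]) (use that sub in auto)
  note h = hseries_beltrami_coeff[OF R(1,2) K M \<mu> \<mu>_bound L(1,2) s(2) sL, folded a_def]
  define A where "A = diag (\<lambda>n. deriv (a n))"
  have "Ck_on 0 A (ball 0 s)" unfolding A_def by (rule Ck_on_diag[OF hseries_deriv[OF h(1)]])
  then have "isCont A 0" using s by (simp add: continuous_on_eq_continuous_at)
  \<comment> \<open>At z = 0 only the term of index 0 survives, and the 0-th coefficient of w is the
    identity. By continuity w_z is nonzero on a smaller disc.\<close>
  moreover have "A 0 = 1" by (simp add: A_def diag_at_0 a_def)
  ultimately have "\<forall>\<^sub>F z in nhds 0. A z \<noteq> 0"
    by (simp add: isCont_def tendsto_imp_eventually_ne eventually_nhds_conv_at)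
  then obtain d where d: "d > 0" "\<And>z. dist z 0 < d \<Longrightarrow> A z \<noteq> 0"
    by (auto simp: eventually_nhds_metric)
  have mu: "diag \<mu> z = G z (cnj z)" if "z \<in> ball 0 s" for z
    unfolding diag_def \<mu>_def
    by (rule sums_unique[symmetric], rule coeff2_sums[OF G]) (use that s R in auto)
  have B: "diag (shift a) z = G z (cnj z) * A z" if "z \<in> ball 0 s" for z
    using diag_shift_beltrami_coeff[OF h[unfolded a_def] that] mu[OF that] by (simp add: a_def A_def)
  show ?thesis
  proof (rule that[of "min s d" "diag a" A])
    show "Ck_on k (diag a) (ball 0 (min s d))" for k
      by (rule Ck_on_subset[OF Ck_on_diag[OF h(1)]]) auto
    fix z assume z: "z \<in> ball (0::complex) (min s d)"
    show "A z \<noteq> 0" using d z by auto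
    have "z \<in> ball 0 s" using z by simp
    note pd = diag_pd[OF h(1) this] B[OF this]
    show "pdx (diag a) z = A z * (1 + G z (cnj z))" "pdy (diag a) z = \<i> * A z * (1 - G z (cnj z))"
      using pd by (simp_all add: A_def algebra_simps)
  qed (use s R d in auto)
qed

subsection \<open>Harmonic functions\<close>

text \<open>The mean value theorem in direction a, applied to the difference of f along b, followed
  by the mean value theorem in direction b. The left side is symmetric in a and b, so exchanging
  them expresses it by the other mixed derivative as well.\<close>

lemma second_difference:
  fixes f fa fab :: "complex \<Rightarrow> real" and a b z :: complex
  assumes t: "t > 0"
    and sub: "\<And>x y. 0 \<le> x \<Longrightarrow> x \<le> t \<Longrightarrow> 0 \<le> y \<Longrightarrow> y \<le> t \<Longrightarrow> z + a * of_real x + b * of_real y \<in> S"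
    and fa: "\<And>w. w \<in> S \<Longrightarrow> ((\<lambda>s. f (w + a * of_real s)) has_real_derivative fa w) (at 0)"
    and fab: "\<And>w. w \<in> S \<Longrightarrow> ((\<lambda>s. fa (w + b * of_real s)) has_real_derivative fab w) (at 0)"
  shows "\<exists>x y. 0 < x \<and> x < t \<and> 0 < y \<and> y < t \<and>
    f (z + a * of_real t + b * of_real t) - f (z + a * of_real t) - f (z + b * of_real t) + f z
      = t\<^sup>2 * fab (z + a * of_real x + b * of_real y)"
proof -
  \<comment> \<open>The hypotheses differentiate translates at 0, while the mean value theorem wants
    derivatives at x.\<close>
  have shifted: "((\<lambda>s. h (w + c * of_real s)) has_real_derivative h' (w + c * of_real x)) (at x)"
    if "((\<lambda>s. h (w + c * of_real x + c * of_real s)) has_real_derivative h' (w + c * of_real x)) (at 0)"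
    for h h' :: "complex \<Rightarrow> real" and w c x
    using that DERIV_shift[of "\<lambda>s. h (w + c * of_real s)" "h' (w + c * of_real x)" 0 x]
    by (simp add: algebra_simps)
  let ?g = "\<lambda>x. f (z + b * of_real t + a * of_real x) - f (z + a * of_real x)"
  have "\<exists>x. 0 < x \<and> x < t \<and> ?g t - ?g 0 =
      (t - 0) * (fa (z + b * of_real t + a * of_real x) - fa (z + a * of_real x))"
    by (rule MVT2[OF t], rule DERIV_diff; rule shifted, rule fa)
      (use sub[of _ t] sub[of _ 0] t in \<open>auto simp: add_ac\<close>)
  then obtain x where x: "0 < x" "x < t" "?g t - ?g 0 =
      (t - 0) * (fa (z + b * of_real t + a * of_real x) - fa (z + a * of_real x))" by blast
  have "\<exists>y. 0 < y \<and> y < t \<and> fa (z + a * of_real x + b * of_real t) - fa (z + a * of_real x + b * of_real 0) =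
      (t - 0) * fab (z + a * of_real x + b * of_real y)"
    by (rule MVT2[OF t], rule shifted, rule fab) (use sub[of x] x in auto)
  then obtain y where "0 < y" "y < t"
    "fa (z + a * of_real x + b * of_real t) - fa (z + a * of_real x) = t * fab (z + a * of_real x + b * of_real y)"
    by auto
  then show ?thesis
    using x by (intro exI[of _ x] exI[of _ y]) (simp add: power2_eq_square add_ac)
qed

lemma has_real_derivative_along_axes:
  fixes f :: "complex \<Rightarrow> real"
  assumes "f differentiable (at z)"
  shows "((\<lambda>s. f (z + 1 * of_real s)) has_real_derivative pdx f z) (at 0)"
    "((\<lambda>s. f (z + \<i> * of_real s)) has_real_derivative pdy f z) (at 0)"
proof -
  have 1: "((\<lambda>t::real. z + c * of_real t) has_derivative (\<lambda>t. c * of_real t)) (at 0)" for c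
    by (auto intro!: derivative_eq_intros)
  have "((\<lambda>s. f (z + c * of_real s)) has_derivative
      (\<lambda>h. Re (c * of_real h) *\<^sub>R pdx f z + Im (c * of_real h) *\<^sub>R pdy f z)) (at 0)" for c
    using diff_chain_at[OF 1[of c], of f "\<lambda>h. Re h *\<^sub>R pdx f z + Im h *\<^sub>R pdy f z"]
      has_derivative_pd[OF assms] by (simp add: o_def)
  from this[of 1] this[of \<i>]
  show "((\<lambda>s. f (z + 1 * of_real s)) has_real_derivative pdx f z) (at 0)"
    "((\<lambda>s. f (z + \<i> * of_real s)) has_real_derivative pdy f z) (at 0)"
    by (simp_all add: has_field_derivative_def mult_commute_abs)
qed

text \<open>Both mixed derivatives, at two points near z, equal the same second difference quotient.
  Continuity at z excludes that they differ there.\<close>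

lemma pd_commute:
  fixes f :: "complex \<Rightarrow> real"
  assumes S: "open S" and C2: "Ck_on 2 f S" and z: "z \<in> S"
  shows "pdx (pdy f) z = pdy (pdx f) z"
proof (rule ccontr)
  assume ne: "pdx (pdy f) z \<noteq> pdy (pdx f) z"
  \<comment> \<open>Half the gap: two values within e of the two mixed derivatives at z cannot
    coincide.\<close>
  define e where "e = \<bar>pdx (pdy f) z - pdy (pdx f) z\<bar> / 2"
  have e: "e > 0" using ne by (simp add: e_def)
  have C2': "\<forall>w\<in>S. f differentiable (at w)" "\<forall>w\<in>S. pdx f differentiable (at w)" "\<forall>w\<in>S. pdy f differentiable (at w)"
     "continuous_on S (pdx (pdy f))" "continuous_on S (pdy (pdx f))"
    using C2 by (auto simp: numeral_2_eq_2)
  have "isCont (pdx (pdy f)) z" "isCont (pdy (pdx f)) z"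
    using C2'(4,5) S z continuous_on_eq_continuous_at by blast+
  then have "\<forall>\<^sub>F w in nhds z. dist (pdx (pdy f) w) (pdx (pdy f) z) < e"
       "\<forall>\<^sub>F w in nhds z. dist (pdy (pdx f) w) (pdy (pdx f) z) < e"
    using e by (auto simp: isCont_def tendsto_iff eventually_nhds_conv_at)
  moreover have "\<forall>\<^sub>F w in nhds z. w \<in> S" using S z by (rule eventually_nhds_in_open)
  ultimately have "\<forall>\<^sub>F w in nhds z. w \<in> S \<and> dist (pdx (pdy f) w) (pdx (pdy f) z) < e
      \<and> dist (pdy (pdx f) w) (pdy (pdx f) z) < e"
    by eventually_elim simp
  then obtain d where d: "d > 0" "\<And>w. dist w z < d \<Longrightarrow> w \<in> S \<and> dist (pdx (pdy f) w) (pdx (pdy f) z) < e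
      \<and> dist (pdy (pdx f) w) (pdy (pdx f) z) < e"
    unfolding eventually_nhds_metric by blast
  define t where "t = d / 3"
  have t: "t > 0" using d by (simp add: t_def)
  have near: "dist (z + of_real x + \<i> * of_real y) z < d" if "0 \<le> x" "x \<le> t" "0 \<le> y" "y \<le> t" for x y
  proof -
    have "norm (of_real x + \<i> * of_real y) \<le> x + y"
      using that norm_triangle_ineq[of "of_real x" "\<i> * of_real y"] by (simp add: norm_mult)
    also have "\<dots> < d" using that d by (simp add: t_def)
    finally show ?thesis by (simp add: dist_norm add.assoc)
  qed
  let ?\<Delta> = "f (z + of_real t + \<i> * of_real t) - f (z + of_real t) - f (z + \<i> * of_real t) + f z"
  have "\<exists>x y. 0 < x \<and> x < t \<and> 0 < y \<and> y < t \<and>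
    f (z + 1 * of_real t + \<i> * of_real t) - f (z + 1 * of_real t) - f (z + \<i> * of_real t) + f z
      = t\<^sup>2 * pdy (pdx f) (z + 1 * of_real x + \<i> * of_real y)"
    by (rule second_difference[where S = S, OF t _ has_real_derivative_along_axes(1) has_real_derivative_along_axes(2)])
      (use near d C2' in auto)
  then obtain x y where xy: "0 < x" "x < t" "0 < y" "y < t"
    "?\<Delta> = t\<^sup>2 * pdy (pdx f) (z + of_real x + \<i> * of_real y)" by auto
  have "\<exists>y x. 0 < y \<and> y < t \<and> 0 < x \<and> x < t \<and>
    f (z + \<i> * of_real t + 1 * of_real t) - f (z + \<i> * of_real t) - f (z + 1 * of_real t) + f z
      = t\<^sup>2 * pdx (pdy f) (z + \<i> * of_real y + 1 * of_real x)"
    by (rule second_difference[where S = S, OF t _ has_real_derivative_along_axes(2) has_real_derivative_along_axes(1)])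
      (use near d C2' in \<open>auto simp: add_ac\<close>)
  then obtain x' y' where xy': "0 < x'" "x' < t" "0 < y'" "y' < t"
    "?\<Delta> = t\<^sup>2 * pdx (pdy f) (z + of_real x' + \<i> * of_real y')" by (auto simp: algebra_simps)
  have "pdy (pdx f) (z + of_real x + \<i> * of_real y) = pdx (pdy f) (z + of_real x' + \<i> * of_real y')"
    using xy(5) xy'(5) t by simp
  moreover have "dist (pdy (pdx f) (z + of_real x + \<i> * of_real y)) (pdy (pdx f) z) < e"
    using d(2)[OF near] xy by auto
  moreover have "dist (pdx (pdy f) (z + of_real x' + \<i> * of_real y')) (pdx (pdy f) z) < e"
    using d(2)[OF near] xy' by auto
  ultimately show False unfolding e_def dist_real_def by (smt (verit) field_sum_of_halves)
qed

text \<open>For u_x - \<i> u_y the Laplace equation is one Cauchy-Riemann equation and the symmetry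
  of second derivatives the other.\<close>

lemma harmonic_on_gradient_holomorphic:
  assumes S: "open S" and u: "harmonic_on u S"
  shows "(\<lambda>z. Complex (pdx u z) (- pdy u z)) holomorphic_on S"
proof (rule holomorphic_onI)
  fix z assume z: "z \<in> S"
  have C2: "Ck_on 2 u S" and lap: "pdx (pdx u) z + pdy (pdy u) z = 0"
    using u z by (auto simp: harmonic_on_def)
  have diff: "pdx u differentiable (at z)" "pdy u differentiable (at z)"
    using C2 z by (auto simp: numeral_2_eq_2)
  note sym = pd_commute[OF S C2 z]
  let ?D = "Complex (pdx (pdx u) z) (- pdx (pdy u) z)"
  have "((\<lambda>z. complex_of_real (pdx u z) + \<i> * complex_of_real (- pdy u z)) has_derivative (\<lambda>h. ?D * h)) (at z)"
    by (rule has_derivative_eq_rhs[OF has_derivative_add[OF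
          bounded_linear.has_derivative[OF bounded_linear_of_real has_derivative_pd[OF diff(1)]]
          has_derivative_mult_right[OF bounded_linear.has_derivative[OF bounded_linear_of_real
            has_derivative_minus[OF has_derivative_pd[OF diff(2)]]]]]])
      (use lap sym in \<open>auto simp: fun_eq_iff complex_eq_iff algebra_simps add_eq_0_iff\<close>)
  then have "((\<lambda>z. Complex (pdx u z) (- pdy u z)) has_field_derivative ?D) (at z)"
    by (simp add: has_field_derivative_def Complex_eq[of "pdx u _"])
  then show "(\<lambda>z. Complex (pdx u z) (- pdy u z)) field_differentiable at z within S"
    by (meson field_differentiable_at_within field_differentiable_def)
qed

section \<open>Vector-valued maps and holomorphic functions as maps of class C^k\<close>

lemma pd_vec:
  fixes X :: "complex \<Rightarrow> real^'n"
  assumes "\<And>i. (\<lambda>z. X z $ i) differentiable (at z)"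
  shows "X differentiable (at z) \<and> pdx X z = (\<chi> i. pdx (\<lambda>z. X z $ i) z) \<and> pdy X z = (\<chi> i. pdy (\<lambda>z. X z $ i) z)"
proof -
  let ?D = "\<lambda>h. Re h *\<^sub>R (\<chi> i. pdx (\<lambda>z. X z $ i) z) + Im h *\<^sub>R (\<chi> i. pdy (\<lambda>z. X z $ i) z)"
  have "(X has_derivative ?D) (at z)"
    unfolding has_derivative_componentwise_within[of X]
  proof
    fix b :: "real^'n" assume "b \<in> Basis"
    then obtain i where b: "b = axis i 1" by (auto simp: Basis_vec_def)
    show "((\<lambda>x. X x \<bullet> b) has_derivative (\<lambda>x. ?D x \<bullet> b)) (at z)"
      using has_derivative_pd[OF assms[of i]] by (simp add: b inner_axis)
  qed
  then show ?thesis by (rule has_derivative_pdI) simp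
qed

lemma Ck_on_vec:
  fixes X :: "complex \<Rightarrow> real^'n"
  assumes S: "open S" and "\<And>i. Ck_on k (\<lambda>z. X z $ i) S"
  shows "Ck_on k X S"
  using assms(2)
proof (induction k arbitrary: X)
  case 0
  then have "continuous_on S (\<lambda>z. \<chi> i. X z $ i)" by (intro continuous_on_vec_lambda) simp
  then show ?case by simp
next
  case (Suc k)
  have 1: "Ck_on k (\<lambda>z. \<chi> i. pdx (\<lambda>z. X z $ i) z) S" "Ck_on k (\<lambda>z. \<chi> i. pdy (\<lambda>z. X z $ i) z) S"
    using Suc.prems by (auto intro!: Suc.IH)
  show ?case
    by (rule Ck_on_SucI[OF S pd_vec 1]) (use Suc.prems in simp)
qed

lemma pd_holomorphic:
  assumes "open S" "f holomorphic_on S" "z \<in> S"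
  shows "f differentiable (at z) \<and> pdx f z = deriv f z \<and> pdy f z = \<i> * deriv f z"
proof -
  have "(f has_derivative (\<lambda>h. deriv f z * h)) (at z)"
    using holomorphic_derivI[OF assms(2,1,3)] by (simp add: has_field_derivative_def)
  then show ?thesis
    by (rule has_derivative_pdI) (simp add: complex_eq_iff algebra_simps)
qed

lemma Ck_on_holomorphic: "open S \<Longrightarrow> f holomorphic_on S \<Longrightarrow> Ck_on k f S"
proof (induction k arbitrary: f)
  case 0 then show ?case by (simp add: holomorphic_on_imp_continuous_on)
next
  case (Suc k)
  have f': "deriv f holomorphic_on S" using Suc.prems by (intro holomorphic_deriv)
  show ?case
    by (rule Ck_on_SucI[OF Suc.prems(1) pd_holomorphic[OF Suc.prems]])
      (use Suc.prems f' in \<open>auto intro!: Suc.IH holomorphic_intros\<close>)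
qed

subsection \<open>Isothermal coordinates\<close>

text \<open>The Beltrami coefficient of the metric \<open>q dz\<^sup>2 + 2 p dz dz\<^sup>* + q\<^sup>* dz\<^sup>*\<^sup>2\<close> is the root of
  \<open>q \<mu>\<^sup>2 - 2 p \<mu> + q\<^sup>* = 0\<close> in the unit disc. Replacing \<open>cnj z\<close> by an independent variable \<open>\<zeta>\<close> makes
  it holomorphic.\<close>

lemma isothermal_coefficient:
  fixes \<phi> :: "'n::finite \<Rightarrow> complex \<Rightarrow> complex"
  assumes S: "open S" "z0 \<in> S" and hol: "\<And>i. \<phi> i holomorphic_on S"
    and imm: "cmod (\<Sum>i\<in>UNIV. (\<phi> i z0)\<^sup>2) < (\<Sum>i\<in>UNIV. (cmod (\<phi> i z0))\<^sup>2)"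
  obtains r G M where "0 < r" "\<And>z. z \<in> ball 0 r \<Longrightarrow> z0 + z \<in> S"
    and "\<And>\<zeta>. \<zeta> \<in> ball 0 r \<Longrightarrow> (\<lambda>z. G z \<zeta>) holomorphic_on ball 0 r"
    and "\<And>z. z \<in> ball 0 r \<Longrightarrow> G z holomorphic_on ball 0 r"
    and "\<And>z \<zeta>. z \<in> ball 0 r \<Longrightarrow> \<zeta> \<in> ball 0 r \<Longrightarrow> cmod (G z \<zeta>) \<le> M"
    and "\<And>z. z \<in> ball 0 r \<Longrightarrow> cmod (G z (cnj z)) < 1"
    and "\<And>z. z \<in> ball 0 r \<Longrightarrow> (\<Sum>i\<in>UNIV. (\<phi> i (z0 + z))\<^sup>2) * (G z (cnj z))\<^sup>2
       - 2 * of_real (\<Sum>i\<in>UNIV. (cmod (\<phi> i (z0 + z)))\<^sup>2) * G z (cnj z)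
       + cnj (\<Sum>i\<in>UNIV. (\<phi> i (z0 + z))\<^sup>2) = 0"
proof -
  obtain r0 where r0: "r0 > 0" "ball z0 r0 \<subseteq> S" using S open_contains_ball by blast
  define f where "f i z = \<phi> i (z0 + z)" for i z
  \<comment> \<open>The reflection of f: holomorphic in \<zeta>, and equal to the conjugate of f(z)
    at \<zeta> = cnj z. Replacing conjugates by g is how the real analytic coefficients are extended
    to two independent variables.\<close>
  define g where "g i \<zeta> = cnj (f i (cnj \<zeta>))" for i \<zeta>
  have f_hol: "f i holomorphic_on ball 0 r0" for i
  proof -
    have "(+) z0 ` ball 0 r0 \<subseteq> S" using r0 by (auto simp: dist_norm)
    then show ?thesis
      using holomorphic_on_compose_gen[of "(+) z0" "ball 0 r0" "\<phi> i" S] hol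
      by (simp add: f_def[abs_def] o_def holomorphic_intros)
  qed
  have g_hol: "g i holomorphic_on ball 0 r0" for i
  proof -
    have "cnj ` ball 0 r0 \<subseteq> ball 0 r0" by auto
    then have "f i holomorphic_on cnj ` ball 0 r0" using f_hol holomorphic_on_subset by blast
    from holomorphic_on_compose_cnj_cnj[OF this] show ?thesis by (simp add: g_def[abs_def] o_def)
  qed
  define q where "q z = (\<Sum>i\<in>UNIV. (f i z)\<^sup>2)" for z
  define q' where "q' \<zeta> = (\<Sum>i\<in>UNIV. (g i \<zeta>)\<^sup>2)" for \<zeta>
  define p where "p z \<zeta> = (\<Sum>i\<in>UNIV. f i z * g i \<zeta>)" for z \<zeta>
  define \<Delta> where "\<Delta> z \<zeta> = (p z \<zeta>)\<^sup>2 - q z * q' \<zeta>" for z \<zeta>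
  define P where "P z = (\<Sum>i\<in>UNIV. (cmod (f i z))\<^sup>2)" for z
  have pP: "p z (cnj z) = of_real (P z)" and qq: "q' (cnj z) = cnj (q z)" for z
    by (simp_all add: p_def P_def g_def q_def q'_def complex_norm_square mult_ac cong: sum.cong_simp)
      (simp_all add: complex_norm_square[symmetric] of_real_sum[symmetric] del: of_real_sum)
  have \<Delta>P: "\<Delta> z (cnj z) = of_real ((P z)\<^sup>2 - (cmod (q z))\<^sup>2)" for z
    using complex_norm_square[of "q z"] by (simp add: \<Delta>_def pP qq)
  \<comment> \<open>The root (p - sqrt \<Delta>) / q with its numerator rationalised. In this form
    it also makes sense where q vanishes, that is, where the given coordinates are already
    isothermal, and the choice of sign gives the root of modulus less than 1.\<close>
  define G where "G z \<zeta> = q' \<zeta> / (p z \<zeta> + csqrt (\<Delta> z \<zeta>))" for z \<zeta>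
  have imm0: "cmod (q 0) < P 0" using imm by (simp add: q_def P_def f_def)
  have P0: "P 0 > 0" using imm0 norm_ge_zero[of "q 0"] by linarith
  have cont_f: "isCont (f i) 0" and cont_g: "isCont (g i) 0" for i
    using f_hol[of i] g_hol[of i] r0 holomorphic_on_imp_continuous_on
    by (metis centre_in_ball continuous_on_eq_continuous_at open_ball)+
  have cont_f': "((\<lambda>x. f i (fst x)) \<longlongrightarrow> f i 0) (nhds 0 \<times>\<^sub>F nhds 0)" for i
    using filterlim_compose[OF _ filterlim_fst] cont_f by (metis continuous_at tendsto_at_iff_tendsto_nhds isCont_def)
  have cont_g': "((\<lambda>x. g i (snd x)) \<longlongrightarrow> g i 0) (nhds 0 \<times>\<^sub>F nhds 0)" for i
    using filterlim_compose[OF _ filterlim_snd] cont_g by (metis continuous_at tendsto_at_iff_tendsto_nhds isCont_def)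
  have lim_p: "((\<lambda>x. p (fst x) (snd x)) \<longlongrightarrow> p 0 0) (nhds 0 \<times>\<^sub>F nhds 0)"
    unfolding p_def by (intro tendsto_intros cont_f' cont_g')
  have lim_q: "((\<lambda>x. q' (snd x)) \<longlongrightarrow> q' 0) (nhds 0 \<times>\<^sub>F nhds 0)"
    unfolding q'_def by (intro tendsto_intros cont_g')
  have lim_\<Delta>: "((\<lambda>x. \<Delta> (fst x) (snd x)) \<longlongrightarrow> \<Delta> 0 0) (nhds 0 \<times>\<^sub>F nhds 0)"
    unfolding \<Delta>_def p_def q_def q'_def by (intro tendsto_intros cont_f' cont_g')
  \<comment> \<open>Re \<Delta> > 0 keeps the argument of \<open>csqrt\<close> off the branch cut,
    the lower bound on Re p keeps the denominator away from 0, and the bound on \<open>q'\<close>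
    then bounds G. All three must hold for z and \<zeta> varying independently, whence the limits
    along the product filter.\<close>
  have at0: "Re (p 0 0) > P 0 / 2" "cmod (q' 0) < cmod (q 0) + 1" "Re (\<Delta> 0 0) > 0"
  proof -
    show "Re (p 0 0) > P 0 / 2" using pP[of 0] P0 by simp
    show "cmod (q' 0) < cmod (q 0) + 1" using qq[of 0] by simp
    have "(cmod (q 0))\<^sup>2 < (P 0)\<^sup>2" using imm0 by (intro power_strict_mono) auto
    then show "Re (\<Delta> 0 0) > 0" using \<Delta>P[of 0] by simp
  qed
  have "\<forall>\<^sub>F x in nhds 0 \<times>\<^sub>F nhds 0. Re (p (fst x) (snd x)) > P 0 / 2 \<and> cmod (q' (snd x)) < cmod (q 0) + 1
      \<and> Re (\<Delta> (fst x) (snd x)) > 0"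
    by (intro eventually_conj order_tendstoD(1)[OF tendsto_Re[OF lim_p] at0(1)]
        order_tendstoD(2)[OF tendsto_norm[OF lim_q] at0(2)] order_tendstoD(1)[OF tendsto_Re[OF lim_\<Delta>] at0(3)])
  then obtain A B where AB: "eventually A (nhds (0::complex))" "eventually B (nhds (0::complex))"
    "\<And>z \<zeta>. A z \<Longrightarrow> B \<zeta> \<Longrightarrow> Re (p z \<zeta>) > P 0 / 2 \<and> cmod (q' \<zeta>) < cmod (q 0) + 1 \<and> Re (\<Delta> z \<zeta>) > 0"
    unfolding eventually_prod_filter by auto
  obtain d1 d2 where d: "d1 > 0" "\<And>z. dist z 0 < d1 \<Longrightarrow> A z" "d2 > 0" "\<And>z. dist z 0 < d2 \<Longrightarrow> B z"
    using AB(1,2) unfolding eventually_nhds_metric by blast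
  define r where "r = min r0 (min d1 d2)"
  have r: "r > 0" "r \<le> r0" using r0 d by (auto simp: r_def)
  have near: "Re (p z \<zeta>) > P 0 / 2 \<and> cmod (q' \<zeta>) < cmod (q 0) + 1 \<and> Re (\<Delta> z \<zeta>) > 0"
    if "z \<in> ball 0 r" "\<zeta> \<in> ball 0 r" for z \<zeta>
    using that by (intro AB(3) d(2,4)) (auto simp: r_def)
  have den: "P 0 / 2 < Re (p z \<zeta> + csqrt (\<Delta> z \<zeta>))" "p z \<zeta> + csqrt (\<Delta> z \<zeta>) \<noteq> 0" "\<Delta> z \<zeta> \<notin> \<real>\<^sub>\<le>\<^sub>0"
    if "z \<in> ball 0 r" "\<zeta> \<in> ball 0 r" for z \<zeta>
  proof -
    have "Re (csqrt (\<Delta> z \<zeta>)) \<ge> 0" using csqrt_principal[of "\<Delta> z \<zeta>"] by auto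
    then show 1: "P 0 / 2 < Re (p z \<zeta> + csqrt (\<Delta> z \<zeta>))"
      unfolding plus_complex.sel(1) using near[OF that] by linarith
    then show "p z \<zeta> + csqrt (\<Delta> z \<zeta>) \<noteq> 0" using P0 by (metis half_gt_zero less_asym zero_complex.sel(1))
    show "\<Delta> z \<zeta> \<notin> \<real>\<^sub>\<le>\<^sub>0" using near[OF that] by (auto simp: complex_nonpos_Reals_iff)
  qed
  have sub: "ball 0 r \<subseteq> ball (0::complex) r0" using r by auto
  have f_hol': "f i holomorphic_on ball 0 r" and g_hol': "g i holomorphic_on ball 0 r" for i
    using f_hol g_hol sub holomorphic_on_subset by blast+
  show ?thesis
  proof (rule that[of r G "(cmod (q 0) + 1) / (P 0 / 2)"])
    show "z0 + z \<in> S" if "z \<in> ball 0 r" for z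
      using that r r0 by (auto simp: dist_norm subset_iff)
    show "(\<lambda>z. G z \<zeta>) holomorphic_on ball 0 r" if "\<zeta> \<in> ball 0 r" for \<zeta>
    proof -
      have "(\<lambda>z. p z \<zeta>) holomorphic_on ball 0 r" unfolding p_def by (intro holomorphic_intros f_hol')
      moreover have "(\<lambda>z. \<Delta> z \<zeta>) holomorphic_on ball 0 r" unfolding \<Delta>_def p_def q_def by (intro holomorphic_intros f_hol')
      ultimately show ?thesis unfolding G_def using den[OF _ that] by (intro holomorphic_intros) auto
    qed
    show "G z holomorphic_on ball 0 r" if "z \<in> ball 0 r" for z
    proof -
      have "(\<lambda>\<zeta>. p z \<zeta>) holomorphic_on ball 0 r" unfolding p_def by (intro holomorphic_intros g_hol')
      moreover have "(\<lambda>\<zeta>. \<Delta> z \<zeta>) holomorphic_on ball 0 r" unfolding \<Delta>_def p_def q'_def by (intro holomorphic_intros g_hol')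
      moreover have "q' holomorphic_on ball 0 r" unfolding q'_def[abs_def] by (intro holomorphic_intros g_hol')
      ultimately show ?thesis unfolding G_def[abs_def] using den[OF that] by (intro holomorphic_intros) auto
    qed
    show "cmod (G z \<zeta>) \<le> (cmod (q 0) + 1) / (P 0 / 2)" if "z \<in> ball 0 r" "\<zeta> \<in> ball 0 r" for z \<zeta>
      unfolding G_def norm_divide
      using near[OF that] den[OF that] P0 complex_Re_le_cmod[of "p z \<zeta> + csqrt (\<Delta> z \<zeta>)"]
      by (intro frac_le) auto
    fix z assume z: "z \<in> ball (0::complex) r"
    then have cz: "cnj z \<in> ball 0 r" by simp
    let ?s = "csqrt (\<Delta> z (cnj z))"
    have "P z \<ge> 0" by (simp add: P_def sum_nonneg)
    \<comment> \<open>On \<zeta> = cnj z the discriminant is the real number P^2 - |q|^2, so its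
      positivity is the positivity of the metric determinant.\<close>
    moreover have "(cmod (q z))\<^sup>2 < (P z)\<^sup>2" using near[OF z cz] by (simp add: \<Delta>P)
    ultimately have "cmod (q z) < P z" using power_less_imp_less_base by blast
    also have "P z \<le> Re (p z (cnj z) + ?s)" using csqrt_principal[of "\<Delta> z (cnj z)"] by (auto simp: pP)
    also have "\<dots> \<le> cmod (p z (cnj z) + ?s)" by (rule complex_Re_le_cmod)
    finally show "cmod (G z (cnj z)) < 1"
      using den(2)[OF z cz] by (simp add: G_def norm_divide qq divide_less_eq)
    have "q z * (G z (cnj z))\<^sup>2 - 2 * p z (cnj z) * G z (cnj z) + q' (cnj z) = 0"
    proof -
      define d where "d = p z (cnj z) + ?s"
      have "?s\<^sup>2 = (p z (cnj z))\<^sup>2 - q z * q' (cnj z)" by (simp add: \<Delta>_def)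
      then have 1: "q z * q' (cnj z) - 2 * p z (cnj z) * d + d\<^sup>2 = 0"
        by (simp add: d_def power2_eq_square algebra_simps)
      have "G z (cnj z) * d = q' (cnj z)" using den(2)[OF z cz] by (simp add: G_def d_def)
      moreover have "(q z * (G z (cnj z))\<^sup>2 - 2 * p z (cnj z) * G z (cnj z) + q' (cnj z)) * d\<^sup>2
          = q z * (G z (cnj z) * d)\<^sup>2 - 2 * p z (cnj z) * d * (G z (cnj z) * d) + q' (cnj z) * d\<^sup>2"
        by (simp add: power2_eq_square algebra_simps)
      ultimately have "(q z * (G z (cnj z))\<^sup>2 - 2 * p z (cnj z) * G z (cnj z) + q' (cnj z)) * d\<^sup>2
          = q' (cnj z) * (q z * q' (cnj z) - 2 * p z (cnj z) * d + d\<^sup>2)"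
        by (simp add: power2_eq_square algebra_simps)
      then show ?thesis using den(2)[OF z cz] 1 by (simp add: d_def)
    qed
    then show "(\<Sum>i\<in>UNIV. (\<phi> i (z0 + z))\<^sup>2) * (G z (cnj z))\<^sup>2
       - 2 * of_real (\<Sum>i\<in>UNIV. (cmod (\<phi> i (z0 + z)))\<^sup>2) * G z (cnj z)
       + cnj (\<Sum>i\<in>UNIV. (\<phi> i (z0 + z))\<^sup>2) = 0"
      unfolding pP qq q_def P_def f_def .
  qed (use r in auto)
qed

text \<open>An injective linear map of finite-dimensional spaces has a left inverse, and continuous
  partial derivatives make the derivative continuous in operator norm. The target is kept general so
  that the same fact serves the coordinate W and the surface X.\<close>

lemma Ck_on_locally_injective:
  fixes f :: "complex \<Rightarrow> 'b::euclidean_space"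
  assumes S: "open S" "z \<in> S" and C1: "Ck_on 1 f S"
    and inj: "\<And>h. Re h *\<^sub>R pdx f z + Im h *\<^sub>R pdy f z = 0 \<Longrightarrow> h = 0"
  obtains d where "d > 0" "ball z d \<subseteq> S" "inj_on f (ball z d)"
proof -
  define D where "D w h = Re h *\<^sub>R pdx f w + Im h *\<^sub>R pdy f w" for w h
  have der: "(f has_derivative D w) (at w)" if "w \<in> S" for w
    using has_derivative_pd[of f w] C1 that by (simp add: D_def[abs_def])
  have lin: "linear (D z)" using der[OF S(2)] has_derivative_linear by blast
  have "inj (D z)"
    using inj linear_injective_0[OF lin] by (simp add: D_def)
  then obtain g' where g': "linear g'" "g' \<circ> D z = id"
    using linear_injective_left_inverse[OF lin] by blast
  show ?thesis
  proof (rule has_derivative_locally_injective[OF S(2,1) _ g'(2) der])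
    show "bounded_linear g'" using g'(1) by (simp add: linear_conv_bounded_linear)
    fix e :: real assume e: "e > 0"
    have "continuous_on S (pdx f)" "continuous_on S (pdy f)" using C1 by auto
    then have "isCont (pdx f) z" "isCont (pdy f) z"
      using S continuous_on_eq_continuous_at by blast+
    then have "\<forall>\<^sub>F w in nhds z. dist (pdx f w) (pdx f z) < e/3" "\<forall>\<^sub>F w in nhds z. dist (pdy f w) (pdy f z) < e/3"
      using e tendstoD[of "pdx f" "pdx f z" "nhds z" "e/3"] tendstoD[of "pdy f" "pdy f z" "nhds z" "e/3"]
      by (simp_all add: continuous_at tendsto_at_iff_tendsto_nhds)
    then have "\<forall>\<^sub>F w in nhds z. onorm (\<lambda>h. D w h - D z h) < e"
    proof eventually_elim
      case (elim w)
      have "onorm (\<lambda>h. D w h - D z h) \<le> 2 * e / 3"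
      proof (rule onorm_le)
        fix h
        have "D w h - D z h = Re h *\<^sub>R (pdx f w - pdx f z) + Im h *\<^sub>R (pdy f w - pdy f z)"
          by (simp add: D_def algebra_simps)
        also have "norm \<dots> \<le> \<bar>Re h\<bar> * norm (pdx f w - pdx f z) + \<bar>Im h\<bar> * norm (pdy f w - pdy f z)"
          by (rule order.trans[OF norm_triangle_ineq]) simp
        also have "\<dots> \<le> norm h * (e/3) + norm h * (e/3)"
          using elim abs_Re_le_cmod[of h] abs_Im_le_cmod[of h] unfolding dist_norm
          by (intro add_mono mult_mono) auto
        finally show "norm (D w h - D z h) \<le> 2 * e / 3 * norm h" by simp
      qed
      then show ?case using e by linarith
    qed
    then show "\<exists>d>0. \<forall>w. dist z w < d \<longrightarrow> onorm (\<lambda>v. D w v - D z v) < e"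
      by (simp add: eventually_nhds_metric dist_commute)
  qed (auto intro: that)
qed

subsection \<open>Distortion and dilatation\<close>

lemma inner_scaled: "(a *\<^sub>R u + b *\<^sub>R v) \<bullet> (c *\<^sub>R u + d *\<^sub>R v)
   = a * c * (u \<bullet> u) + (a * d + b * c) * (u \<bullet> v) + b * d * (v \<bullet> v)" for u v :: "'a::real_inner"
  by (simp add: inner_add_left inner_add_right inner_commute[of v u] algebra_simps)

lemma cross_scaled: "(a *\<^sub>R u + b *\<^sub>R v) \<times> (c *\<^sub>R u + d *\<^sub>R v) = (a * d - b * c) *\<^sub>R (u \<times> v)"
  for u v :: "real^3"
  by (simp add: cross_add_left cross_add_right cross_mult_left cross_mult_right cross_skew[of v u] algebra_simps)

text \<open>With x, y as X_x, X_y and (a, b), (c, d) as the components of W_x, W_y, the hypothesis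
  says that dW is null for the complexified inverse metric. In the frame u, v the same expression is
  J^2 times v.v - u.u - 2 \<i> u.v, where J = ad - bc.\<close>

lemma conformal_of_pullback_null:
  fixes u v :: "'a::real_inner"
  assumes "a * d - b * c \<noteq> 0"
    and Xx: "x = a *\<^sub>R u + b *\<^sub>R v" and Xy: "y = c *\<^sub>R u + d *\<^sub>R v"
    and null: "(Complex c d)\<^sup>2 * of_real (x \<bullet> x) - 2 * Complex a b * Complex c d * of_real (x \<bullet> y)
       + (Complex a b)\<^sup>2 * of_real (y \<bullet> y) = 0"
  shows "u \<bullet> u = v \<bullet> v" "u \<bullet> v = 0"
proof -
  let ?e = "u \<bullet> u" and ?f = "u \<bullet> v" and ?g = "v \<bullet> v" and ?J = "a * d - b * c"
  let ?N = "(Complex c d)\<^sup>2 * of_real (x \<bullet> x) - 2 * Complex a b * Complex c d * of_real (x \<bullet> y)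
       + (Complex a b)\<^sup>2 * of_real (y \<bullet> y)"
  have E: "x \<bullet> x = a * a * ?e + (a * b + b * a) * ?f + b * b * ?g"
    "x \<bullet> y = a * c * ?e + (a * d + b * c) * ?f + b * d * ?g"
    "y \<bullet> y = c * c * ?e + (c * d + d * c) * ?f + d * d * ?g"
    unfolding Xx Xy inner_scaled by simp_all
  have "Re ?N = ?J\<^sup>2 * (?g - ?e)" "Im ?N = - 2 * ?J\<^sup>2 * ?f"
    unfolding E by (simp_all add: power2_eq_square) (simp_all add: algebra_simps)
  then show "?e = ?g" "?f = 0" using null assms(1) by auto
qed

text \<open>With N the sum of the squared moduli of the partial derivatives and J the Jacobian, 4
  |\<phi>_z|^2 = N + 2 J and 4 |\<phi>_(cnj z)|^2 = N - 2 J; dividing both by 2 J gives D + 1 and D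
  - 1.\<close>

lemma dilatation_eq:
  fixes \<phi> :: "complex \<Rightarrow> complex"
  assumes "jacobian \<phi> z > 0"
  defines "D \<equiv> ((cmod (pdx \<phi> z))\<^sup>2 + (cmod (pdy \<phi> z))\<^sup>2) / (2 * jacobian \<phi> z)"
  shows "dilatation \<phi> z = sqrt ((D - 1) / (D + 1))"
proof -
  let ?J = "jacobian \<phi> z" and ?N = "(cmod (pdx \<phi> z))\<^sup>2 + (cmod (pdy \<phi> z))\<^sup>2"
  have 1: "4 * (cmod (wirtinger \<phi> z))\<^sup>2 = ?N + 2 * ?J" "4 * (cmod (wirtinger_bar \<phi> z))\<^sup>2 = ?N - 2 * ?J"
    unfolding wirtinger_def wirtinger_bar_def jacobian_def cmod_power2
    by (simp_all add: power2_eq_square) (simp_all add: field_simps)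
  have "dilatation \<phi> z = sqrt ((4 * (cmod (wirtinger_bar \<phi> z))\<^sup>2) / (4 * (cmod (wirtinger \<phi> z))\<^sup>2))"
    by (simp add: dilatation_def norm_divide real_sqrt_divide)
  also have "(4 * (cmod (wirtinger_bar \<phi> z))\<^sup>2) / (4 * (cmod (wirtinger \<phi> z))\<^sup>2) = (?N - 2 * ?J) / (?N + 2 * ?J)"
    unfolding 1 ..
  also have "\<dots> = (D - 1) / (D + 1)"
  proof -
    have "D - 1 = (?N - 2 * ?J) / (2 * ?J)" "D + 1 = (?N + 2 * ?J) / (2 * ?J)"
      using assms(1) by (simp_all add: D_def diff_divide_distrib add_divide_distrib)
    then show ?thesis using assms(1) by simp
  qed
  finally show ?thesis .
qed

lemma factor_through:
  fixes W :: "complex \<Rightarrow> complex" and X Y :: "complex \<Rightarrow> real^3"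
  assumes "open U" "z \<in> U" "\<And>u. u \<in> U \<Longrightarrow> Y (W u) = X u"
    and "W differentiable (at z)" "Y differentiable (at (W z))"
  shows "pdx X z = Re (pdx W z) *\<^sub>R pdx Y (W z) + Im (pdx W z) *\<^sub>R pdy Y (W z)"
    and "pdy X z = Re (pdy W z) *\<^sub>R pdx Y (W z) + Im (pdy W z) *\<^sub>R pdy Y (W z)"
    and "pdx X z \<times> pdy X z = jacobian W z *\<^sub>R (pdx Y (W z) \<times> pdy Y (W z))"
proof -
  show x: "pdx X z = Re (pdx W z) *\<^sub>R pdx Y (W z) + Im (pdx W z) *\<^sub>R pdy Y (W z)"
   and y: "pdy X z = Re (pdy W z) *\<^sub>R pdx Y (W z) + Im (pdy W z) *\<^sub>R pdy Y (W z)"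
    using pd_compose[OF assms(4,5)] pd_cong[OF assms(1,2), of "\<lambda>u. Y (W u)" X] assms(3) by auto
  show "pdx X z \<times> pdy X z = jacobian W z *\<^sub>R (pdx Y (W z) \<times> pdy Y (W z))"
    unfolding x y cross_scaled by (simp add: jacobian_def)
qed

lemma norm_cross_orthogonal:
  fixes u v :: "real^3"
  assumes "u \<bullet> v = 0" "norm u = norm v"
  shows "norm (u \<times> v) = (norm u)\<^sup>2"
proof -
  have "(norm (u \<times> v))\<^sup>2 = ((norm u)\<^sup>2)\<^sup>2"
    using norm_cross_dot[of u v] assms by (simp add: power2_eq_square)
  then show ?thesis by (rule power2_eq_imp_eq) auto
qed

lemma smooth_on_differentiable: "smooth_on f S \<Longrightarrow> z \<in> S \<Longrightarrow> f differentiable (at z)"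
  using Ck_on.simps(2)[of 0 f S] by (auto simp: smooth_on_def simp del: Ck_on.simps)

text \<open>In an isothermal frame the lengths of X_x and X_y are those of the partial derivatives
  of the transition map times one common factor, and areas scale by its square. The distortion of
  the transition map is therefore that of X, whichever chart is used.\<close>

lemma dilatation_transition:
  assumes iso: "isothermal_parametrization X U Y V" and z: "z \<in> U"
    and imm: "pdx X z \<times> pdy X z \<noteq> 0"
  shows "dilatation (transition Y V X) z = sqrt ((distortion X z - 1) / (distortion X z + 1))"
proof -
  define \<tau> where "\<tau> = transition Y V X"
  have iso': "open U" "isothermal_on Y V" "inj_on Y V" "Y ` V = X ` U" "smooth_on \<tau> U"
    "gauss_map Y (\<tau> z) = gauss_map X z"
    using iso z by (auto simp: isothermal_parametrization_def domain_def \<tau>_def)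
  have \<tau>: "\<tau> u \<in> V \<and> Y (\<tau> u) = X u" if "u \<in> U" for u
  proof -
    have "X u \<in> Y ` V" using that iso'(4) by auto
    then show ?thesis
      using iso'(3) by (simp add: \<tau>_def transition_def f_the_inv_into_f the_inv_into_into)
  qed
  have "\<tau> differentiable (at z)" using smooth_on_differentiable[OF iso'(5) z] .
  moreover have "Y differentiable (at (\<tau> z))"
    using iso'(2) \<tau>[OF z] by (auto simp: isothermal_on_def intro: smooth_on_differentiable)
  ultimately have f: "pdx X z = Re (pdx \<tau> z) *\<^sub>R pdx Y (\<tau> z) + Im (pdx \<tau> z) *\<^sub>R pdy Y (\<tau> z)"
    "pdy X z = Re (pdy \<tau> z) *\<^sub>R pdx Y (\<tau> z) + Im (pdy \<tau> z) *\<^sub>R pdy Y (\<tau> z)"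
    "pdx X z \<times> pdy X z = jacobian \<tau> z *\<^sub>R (pdx Y (\<tau> z) \<times> pdy Y (\<tau> z))"
    using factor_through[OF iso'(1) z, of Y \<tau> X] \<tau> by blast+
  let ?u = "pdx Y (\<tau> z)" and ?v = "pdy Y (\<tau> z)"
  have uv: "norm ?u = norm ?v" "?u \<bullet> ?v = 0" "?u \<times> ?v \<noteq> 0"
    using iso'(2) \<tau>[OF z] by (auto simp: isothermal_on_def immersion_on_def)
  then have e: "(norm ?u)\<^sup>2 > 0" by auto
  \<comment> \<open>A negative Jacobian would reverse the unit normal, against the agreement of
    orientations required of the chart.\<close>
  have J: "jacobian \<tau> z > 0"
  proof (rule ccontr)
    assume "\<not> jacobian \<tau> z > 0"
    moreover have "jacobian \<tau> z \<noteq> 0" using imm f(3) by auto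
    ultimately have "jacobian \<tau> z < 0" by simp
    then have "gauss_map X z = - gauss_map Y (\<tau> z)"
      unfolding gauss_map_def f(3) using uv(3) by (simp add: field_simps)
    then have "2 *\<^sub>R gauss_map Y (\<tau> z) = 0" using iso'(6) by (simp add: scaleR_2)
    then have "gauss_map Y (\<tau> z) = 0" by simp
    then show False using uv(3) by (simp add: gauss_map_def)
  qed
  have n: "(norm (pdx X z))\<^sup>2 = (cmod (pdx \<tau> z))\<^sup>2 * (norm ?u)\<^sup>2"
    "(norm (pdy X z))\<^sup>2 = (cmod (pdy \<tau> z))\<^sup>2 * (norm ?u)\<^sup>2"
  proof -
    have "?v \<bullet> ?v = ?u \<bullet> ?u" using uv(1) by (simp add: norm_eq)
    then show "(norm (pdx X z))\<^sup>2 = (cmod (pdx \<tau> z))\<^sup>2 * (norm ?u)\<^sup>2"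
    "(norm (pdy X z))\<^sup>2 = (cmod (pdy \<tau> z))\<^sup>2 * (norm ?u)\<^sup>2"
      unfolding cmod_power2 unfolding power2_norm_eq_inner f(1,2) inner_scaled using uv(2)
      by (simp_all add: power2_eq_square algebra_simps)
  qed
  have "distortion X z = ((cmod (pdx \<tau> z))\<^sup>2 + (cmod (pdy \<tau> z))\<^sup>2) / (2 * jacobian \<tau> z)"
    unfolding distortion_def n f(3) using J e norm_cross_orthogonal[OF uv(2,1)]
    by (simp add: distrib_right[symmetric])
  then show ?thesis using dilatation_eq[OF J] by (simp add: \<tau>_def)
qed

text \<open>Here u, v are X_x, X_y and a, b are n_x, n_y. The product of a \<times> b with u
  \<times> v is the determinant of the matrix of inner products, which is -(L^2 + M^2). This fixes
  both the length and the direction of a \<times> b.\<close>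

lemma gauss_map_distortion_algebra:
  fixes n a b u v :: "real^3" and L M :: real
  assumes W: "u \<times> v \<noteq> 0" and n: "n = (u \<times> v) /\<^sub>R norm (u \<times> v)"
    and orth: "n \<bullet> a = 0" "n \<bullet> b = 0"
    and II: "a \<bullet> u = - L" "a \<bullet> v = - M" "b \<bullet> u = - M" "b \<bullet> v = L"
  shows "a \<times> b = (- ((L\<^sup>2 + M\<^sup>2) / norm (u \<times> v))) *\<^sub>R n"
    and "a \<times> b \<noteq> 0 \<Longrightarrow> L\<^sup>2 + M\<^sup>2 > 0"
    and "a \<times> b \<noteq> 0 \<Longrightarrow> ((norm a)\<^sup>2 + (norm b)\<^sup>2) / (2 * norm (a \<times> b))
       = ((norm u)\<^sup>2 + (norm v)\<^sup>2) / (2 * norm (u \<times> v))"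
proof -
  let ?W = "u \<times> v"
  have nW: "norm ?W > 0" using W by simp
  have Wn: "?W = norm ?W *\<^sub>R n" using W by (simp add: n)
  have n1: "norm n = 1" using W by (simp add: n)
  then have n2: "n \<bullet> n = 1" by (simp add: norm_eq_1)
  have "n \<times> (a \<times> b) = 0" using orth by (simp add: Lagrange)
  then have par: "a \<times> b = (n \<bullet> (a \<times> b)) *\<^sub>R n"
    using Lagrange[of n n "a \<times> b"] n2 by simp
  have "(a \<times> b) \<bullet> ?W = (a \<bullet> u) * (b \<bullet> v) - (a \<bullet> v) * (b \<bullet> u)"
    by (simp add: cross3_simps)
  then have "norm ?W * (n \<bullet> (a \<times> b)) = - (L\<^sup>2 + M\<^sup>2)"
    using II by (subst (asm) Wn) (simp add: inner_commute power2_eq_square)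
  then have "n \<bullet> (a \<times> b) = - ((L\<^sup>2 + M\<^sup>2) / norm ?W)" using nW by (simp add: field_simps)
  then show ab: "a \<times> b = (- ((L\<^sup>2 + M\<^sup>2) / norm ?W)) *\<^sub>R n" using par by simp
  show pos: "L\<^sup>2 + M\<^sup>2 > 0" if "a \<times> b \<noteq> 0"
    using that ab by (metis divide_eq_0_iff neg_equal_0_iff_equal scale_zero_left sum_power2_gt_zero_iff sum_power2_eq_zero_iff)
  \<comment> \<open>The length of a tangent vector recovered from its inner products with u and v: a
    cross product with the normal u \<times> v preserves length up to the factor |u \<times> v|, and
    expands in the frame u, v.\<close>
  have tangent: "(norm c)\<^sup>2 * (norm ?W)\<^sup>2
      = (c \<bullet> v)\<^sup>2 * (norm u)\<^sup>2 - 2 * (c \<bullet> u) * (c \<bullet> v) * (u \<bullet> v) + (c \<bullet> u)\<^sup>2 * (norm v)\<^sup>2"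
    if "n \<bullet> c = 0" for c
  proof -
    have "c \<bullet> ?W = 0" using that by (subst Wn) (simp add: inner_commute)
    then have "(norm c)\<^sup>2 * (norm ?W)\<^sup>2 = (norm (c \<times> ?W))\<^sup>2"
      using norm_cross_dot[of c ?W] by (simp add: power_mult_distrib)
    also have "c \<times> ?W = (c \<bullet> v) *\<^sub>R u + (- (c \<bullet> u)) *\<^sub>R v" by (simp add: Lagrange)
    finally show ?thesis
      unfolding power2_norm_eq_inner inner_scaled by (simp add: power2_eq_square algebra_simps)
  qed
  \<comment> \<open>The mixed terms are -2 L M (u.v) for a and +2 L M (u.v) for b, and cancel; this
    is where trace freeness yields equal distortions.\<close>
  have sum: "((norm a)\<^sup>2 + (norm b)\<^sup>2) * (norm ?W)\<^sup>2 = (L\<^sup>2 + M\<^sup>2) * ((norm u)\<^sup>2 + (norm v)\<^sup>2)"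
    using tangent[OF orth(1)] tangent[OF orth(2)] II by (simp add: algebra_simps)
  show "((norm a)\<^sup>2 + (norm b)\<^sup>2) / (2 * norm (a \<times> b)) = ((norm u)\<^sup>2 + (norm v)\<^sup>2) / (2 * norm ?W)"
    if "a \<times> b \<noteq> 0"
  proof -
    have LM: "L\<^sup>2 + M\<^sup>2 > 0" using pos[OF that] .
    have "norm (a \<times> b) = (L\<^sup>2 + M\<^sup>2) / norm ?W" unfolding ab using LM nW n1 by simp
    then have "((norm a)\<^sup>2 + (norm b)\<^sup>2) / (2 * norm (a \<times> b))
        = (((norm a)\<^sup>2 + (norm b)\<^sup>2) * (norm ?W)\<^sup>2) / ((L\<^sup>2 + M\<^sup>2) * (2 * norm ?W))"
      using nW LM by (simp add: power2_eq_square)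
    also have "\<dots> = ((norm u)\<^sup>2 + (norm v)\<^sup>2) / (2 * norm ?W)"
      unfolding sum using LM by auto
    finally show ?thesis .
  qed
qed

text \<open>Stereographic projection scales tangent vectors of the sphere by 1/s with s = 1 - x_3,
  and areas by 1/s^2, so the distortion is kept. Seen from the north pole it reverses the
  orientation given by the outer normal, which turns the factor -\<kappa> into a positive
  Jacobian.\<close>

lemma stereographic_dilatation:
  fixes m :: "complex \<Rightarrow> real^3"
  assumes diff: "m differentiable (at z)" and unit: "norm (m z) = 1"
    and orth: "m z \<bullet> pdx m z = 0" "m z \<bullet> pdy m z = 0"
    and cross: "pdx m z \<times> pdy m z = (- \<kappa>) *\<^sub>R m z" "\<kappa> > 0" and np: "m z \<noteq> north_pole"
  shows "dilatation (\<lambda>w. stereographic (m w)) z = sqrt ((distortion m z - 1) / (distortion m z + 1))"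
proof -
  let ?a = "pdx m z" and ?b = "pdy m z" and ?t = "m z $ 3"
  define s where "s = 1 - ?t"
  have one: "m z $ 1 * m z $ 1 + m z $ 2 * m z $ 2 + ?t * ?t = 1"
    using unit by (simp add: norm_eq_1 inner_vec_def sum_3)
  have "?t \<noteq> 1"
  proof
    assume "?t = 1"
    then have "m z $ 1 = 0" "m z $ 2 = 0" using one by (auto simp: sum_squares_eq_zero_iff)
    then show False using np \<open>?t = 1\<close> by (simp add: north_pole_def vec_eq_iff forall_3)
  qed
  then have s: "s \<noteq> 0" "1 - m z $ 3 = s" by (simp_all add: s_def)
  define g where "g w = stereographic (m w)" for w
  \<comment> \<open>The differential of the projection at m(z), applied to d.\<close>
  let ?P = "\<lambda>d :: real^3. Complex ((d$1 * s + m z $ 1 * d$3) / s\<^sup>2) ((d$2 * s + m z $ 2 * d$3) / s\<^sup>2)"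
  have mi: "((\<lambda>w. m w $ i) has_derivative (\<lambda>h. (Re h *\<^sub>R ?a + Im h *\<^sub>R ?b) $ i)) (at z)" for i
    by (rule bounded_linear.has_derivative[OF bounded_linear_vec_nth has_derivative_pd[OF diff]])
  have qi: "((\<lambda>w. m w $ i / (1 - m w $ 3)) has_derivative
     (\<lambda>h. Re h * ((?a$i * s + m z $ i * ?a$3) / s\<^sup>2) + Im h * ((?b$i * s + m z $ i * ?b$3) / s\<^sup>2))) (at z)" for i
    by (rule has_derivative_eq_rhs[OF has_derivative_divide'[OF mi has_derivative_diff[OF has_derivative_const mi]]])
      (use s(1) in \<open>simp only: s(2) not_False_eq_True\<close>,
       simp only: fun_eq_iff s(2) power2_eq_square,
       simp add: add_divide_distrib[symmetric] algebra_simps)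
  have "((\<lambda>w. complex_of_real (m w $ 1 / (1 - m w $ 3)) + \<i> * complex_of_real (m w $ 2 / (1 - m w $ 3)))
      has_derivative (\<lambda>h. Re h *\<^sub>R ?P ?a + Im h *\<^sub>R ?P ?b)) (at z)"
    by (rule has_derivative_eq_rhs[OF has_derivative_add[OF
          bounded_linear.has_derivative[OF bounded_linear_of_real qi]
          has_derivative_mult_right[OF bounded_linear.has_derivative[OF bounded_linear_of_real qi]]]])
      (auto simp: fun_eq_iff complex_eq_iff)
  then have "(g has_derivative (\<lambda>h. Re h *\<^sub>R ?P ?a + Im h *\<^sub>R ?P ?b)) (at z)"
    by (simp add: g_def[abs_def] stereographic_def Complex_eq[of "_ / _"])
  then have pd: "pdx g z = ?P ?a" "pdy g z = ?P ?b"
    using has_derivative_pdI[of g _ z "?P ?a" "?P ?b"] by blast+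
  have conf: "(cmod (?P d))\<^sup>2 = (norm d)\<^sup>2 / s\<^sup>2" if "m z \<bullet> d = 0" for d
  proof -
    have "m z $ 1 * d $ 1 + m z $ 2 * d $ 2 + ?t * d $ 3 = 0"
      using that by (simp add: inner_vec_def sum_3)
    then have "(d$1 * s + m z $ 1 * d$3)\<^sup>2 + (d$2 * s + m z $ 2 * d$3)\<^sup>2 = s\<^sup>2 * (d$1 * d$1 + d$2 * d$2 + d$3 * d$3)"
      using one unfolding s_def by algebra
    then have "(cmod (?P d))\<^sup>2 = s\<^sup>2 * (d$1 * d$1 + d$2 * d$2 + d$3 * d$3) / (s\<^sup>2)\<^sup>2"
      by (simp add: cmod_power2 power_divide add_divide_distrib[symmetric])
    moreover have "(norm d)\<^sup>2 = d$1 * d$1 + d$2 * d$2 + d$3 * d$3"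
      by (simp add: power2_norm_eq_inner inner_vec_def sum_3)
    ultimately show ?thesis using s by (simp add: power2_eq_square)
  qed
  have jac: "jacobian g z = \<kappa> / s\<^sup>2"
  proof -
    have c: "?a$2 * ?b$3 - ?b$2 * ?a$3 = - \<kappa> * m z $ 1" "?a$3 * ?b$1 - ?b$3 * ?a$1 = - \<kappa> * m z $ 2"
      "?a$1 * ?b$2 - ?b$1 * ?a$2 = - \<kappa> * ?t"
      using cross(1) cross_components[of ?a ?b] by simp_all
    have "(?a$1 * s + m z $ 1 * ?a$3) * (?b$2 * s + m z $ 2 * ?b$3)
       - (?a$2 * s + m z $ 2 * ?a$3) * (?b$1 * s + m z $ 1 * ?b$3) = \<kappa> * s\<^sup>2"
      using c one unfolding s_def by algebra
    then have "jacobian g z = \<kappa> * s\<^sup>2 / (s\<^sup>2 * s\<^sup>2)"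
      unfolding jacobian_def pd by (simp add: diff_divide_distrib[symmetric] power2_eq_square)
    then show ?thesis using s by (simp add: power2_eq_square)
  qed
  have "distortion m z = ((cmod (pdx g z))\<^sup>2 + (cmod (pdy g z))\<^sup>2) / (2 * jacobian g z)"
    unfolding distortion_def pd conf[OF orth(1)] conf[OF orth(2)] jac cross(1)
    using s cross(2) unit by (simp add: add_divide_distrib[symmetric])
  moreover have "jacobian g z > 0" using jac cross(2) s by simp
  ultimately show ?thesis using dilatation_eq[of g z] by (simp add: g_def[abs_def])
qed

subsection \<open>Harmonic surfaces\<close>

text \<open>Twice the Wirtinger derivative of the \<open>i\<close>-th coordinate of \<open>X\<close>.\<close>

definition gradient_form :: "(complex \<Rightarrow> real^3) \<Rightarrow> 3 \<Rightarrow> complex \<Rightarrow> complex" where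
  "gradient_form X i z = Complex (pdx (\<lambda>z. X z $ i) z) (- pdy (\<lambda>z. X z $ i) z)"

context
  fixes X :: "complex \<Rightarrow> real^3" and S :: "complex set"
  assumes S: "open S" and harm: "\<And>i. harmonic_on (\<lambda>z. X z $ i) S"
begin

lemma gradient_form_holomorphic: "gradient_form X i holomorphic_on S"
  using harmonic_on_gradient_holomorphic[OF S harm[of i]] by (simp add: gradient_form_def[abs_def])

lemma pd_gradient_form:
  assumes "z \<in> S"
  shows "X differentiable (at z) \<and> pdx X z = (\<chi> i. Re (gradient_form X i z))
    \<and> pdy X z = (\<chi> i. - Im (gradient_form X i z))"
  using pd_vec[of X z] harm assms by (simp add: gradient_form_def harmonic_on_def numeral_2_eq_2)

text \<open>\<open>harmonic_on\<close> asks for class C^2 only; higher regularity comes from the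
  holomorphic functions whose real and imaginary parts are the first derivatives.\<close>

lemma Ck_on_harmonic_surface: "Ck_on k X S"
proof -
  have "Ck_on (Suc k) X S"
  proof (rule Ck_on_SucI[OF S pd_gradient_form])
    have 1: "Ck_on k (gradient_form X i) S" for i
      by (rule Ck_on_holomorphic[OF S gradient_form_holomorphic])
    show "Ck_on k (\<lambda>z. \<chi> i. Re (gradient_form X i z)) S"
      by (rule Ck_on_vec[OF S]) (simp add: Ck_on_bounded_linear[OF S bounded_linear_Re 1])
    show "Ck_on k (\<lambda>z. \<chi> i. - Im (gradient_form X i z)) S"
      by (rule Ck_on_vec[OF S])
        (simp add: Ck_on_bounded_linear[OF S bounded_linear_minus[OF bounded_linear_Im] 1])
  qed
  then show ?thesis by (rule Ck_on_SucD)
qed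

text \<open>In terms of E, F, G the two sums are E - G - 2 \<i> F and E + G. The difference of their
  squared moduli is 4 (E G - F^2), that is, 4 times the squared length of the normal X_x \<times>
  X_y, whence the strict inequality for an immersion.\<close>

lemma gradient_form_metric:
  assumes "z \<in> S"
  shows "(\<Sum>i\<in>UNIV. (gradient_form X i z)\<^sup>2)
      = Complex (pdx X z \<bullet> pdx X z - pdy X z \<bullet> pdy X z) (- 2 * (pdx X z \<bullet> pdy X z))"
    and "(\<Sum>i\<in>UNIV. (cmod (gradient_form X i z))\<^sup>2) = pdx X z \<bullet> pdx X z + pdy X z \<bullet> pdy X z"
    and "pdx X z \<times> pdy X z \<noteq> 0 \<Longrightarrow> cmod (\<Sum>i\<in>UNIV. (gradient_form X i z)\<^sup>2)
      < (\<Sum>i\<in>UNIV. (cmod (gradient_form X i z))\<^sup>2)"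
proof -
  let ?Q = "\<Sum>i\<in>UNIV. (gradient_form X i z)\<^sup>2" and ?P = "\<Sum>i\<in>UNIV. (cmod (gradient_form X i z))\<^sup>2"
  note pd = pd_gradient_form[OF assms]
  let ?E = "pdx X z \<bullet> pdx X z" and ?F = "pdx X z \<bullet> pdy X z" and ?G = "pdy X z \<bullet> pdy X z"
  show Q: "?Q = Complex (?E - ?G) (- 2 * ?F)"
    using pd by (simp add: complex_eq_iff inner_vec_def sum_subtractf sum_negf sum_distrib_left
        power2_eq_square mult_ac)
  show P: "?P = ?E + ?G"
    using pd unfolding cmod_power2 by (simp add: inner_vec_def sum.distrib power2_eq_square)
  show "cmod ?Q < ?P" if "pdx X z \<times> pdy X z \<noteq> 0"
  proof -
    have "?E * ?G - ?F\<^sup>2 = (norm (pdx X z \<times> pdy X z))\<^sup>2"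
      using norm_cross_dot[of "pdx X z" "pdy X z"] by (simp add: power_mult_distrib power2_norm_eq_inner)
    then have "?E * ?G - ?F\<^sup>2 > 0" using that by simp
    moreover have "(cmod ?Q)\<^sup>2 = ?P\<^sup>2 - 4 * (?E * ?G - ?F\<^sup>2)"
      unfolding Q P unfolding cmod_power2 by (simp add: power2_eq_square algebra_simps)
    ultimately have "(cmod ?Q)\<^sup>2 < ?P\<^sup>2" by simp
    moreover have "?P \<ge> 0" by (simp add: sum_nonneg)
    ultimately show ?thesis by (rule power_less_imp_less_base)
  qed
qed

text \<open>For a solution W of the Beltrami equation with W_z = a, the null form in the conclusion
  is -a^2 times the quadratic polynomial of which the coefficient \<open>\<mu>\<close> is a root,
  and the Jacobian is |a|^2 (1 - |\<mu>|^2). The series is centred at 0, so everything is translated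
  by z0.\<close>

lemma isothermal_coordinate_exists:
  assumes z0: "z0 \<in> S" and imm: "pdx X z0 \<times> pdy X z0 \<noteq> 0"
  obtains s W where "0 < s" "ball z0 s \<subseteq> S" "\<And>k. Ck_on k W (ball z0 s)"
    and "\<And>u. u \<in> ball z0 s \<Longrightarrow> jacobian W u > 0"
    and "\<And>u. u \<in> ball z0 s \<Longrightarrow> (pdy W u)\<^sup>2 * of_real (pdx X u \<bullet> pdx X u)
       - 2 * pdx W u * pdy W u * of_real (pdx X u \<bullet> pdy X u) + (pdx W u)\<^sup>2 * of_real (pdy X u \<bullet> pdy X u) = 0"
proof -
  obtain r G M where G: "0 < r" "\<And>z. z \<in> ball 0 r \<Longrightarrow> z0 + z \<in> S"
    "\<And>\<zeta>. \<zeta> \<in> ball 0 r \<Longrightarrow> (\<lambda>z. G z \<zeta>) holomorphic_on ball 0 r"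
    "\<And>z. z \<in> ball 0 r \<Longrightarrow> G z holomorphic_on ball 0 r"
    "\<And>z \<zeta>. z \<in> ball 0 r \<Longrightarrow> \<zeta> \<in> ball 0 r \<Longrightarrow> cmod (G z \<zeta>) \<le> M"
    and G1: "\<And>z. z \<in> ball 0 r \<Longrightarrow> cmod (G z (cnj z)) < 1"
    and G2: "\<And>z. z \<in> ball 0 r \<Longrightarrow> (\<Sum>i\<in>UNIV. (gradient_form X i (z0 + z))\<^sup>2) * (G z (cnj z))\<^sup>2
       - 2 * of_real (\<Sum>i\<in>UNIV. (cmod (gradient_form X i (z0 + z)))\<^sup>2) * G z (cnj z)
       + cnj (\<Sum>i\<in>UNIV. (gradient_form X i (z0 + z))\<^sup>2) = 0"
    by (rule isothermal_coefficient[OF S z0 gradient_form_holomorphic gradient_form_metric(3)[OF z0 imm]]) blast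
  obtain s w A where w: "0 < s" "s \<le> r" "\<And>k. Ck_on k w (ball 0 s)"
    "\<And>z. z \<in> ball 0 s \<Longrightarrow> A z \<noteq> 0"
    "\<And>z. z \<in> ball 0 s \<Longrightarrow> pdx w z = A z * (1 + G z (cnj z))"
    "\<And>z. z \<in> ball 0 s \<Longrightarrow> pdy w z = \<i> * A z * (1 - G z (cnj z))"
    by (rule beltrami_equation_local_solution[OF G(1,3-5)]) blast+
  have transl: "(\<lambda>u. u - z0) differentiable (at u) \<and> pdx (\<lambda>u. u - z0) u = 1 \<and> pdy (\<lambda>u. u - z0) u = \<i>" for u
    by (rule has_derivative_pdI[of _ "\<lambda>h. h"]) (auto intro!: derivative_eq_intros simp: complex_eq_iff)
  have Ck_transl: "Ck_on k (\<lambda>u. u - z0) (ball z0 s)" for k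
    by (rule Ck_on_holomorphic) (auto intro!: holomorphic_intros)
  have in_ball: "u - z0 \<in> ball 0 s" if "u \<in> ball z0 s" for u
    using that by (simp add: dist_norm norm_minus_commute)
  define W where "W u = w (u - z0)" for u
  have Ck_W: "Ck_on k W (ball z0 s)" for k
    unfolding W_def[abs_def]
    by (rule Ck_on_compose[OF open_ball open_ball _ Ck_transl w(3)]) (use in_ball in auto)
  have sub: "u \<in> S" if "u \<in> ball z0 s" for u
    using G(2)[of "u - z0"] in_ball[OF that] w(2) by simp
  have pdW: "pdx W u = A (u - z0) * (1 + G (u - z0) (cnj (u - z0)))"
    "pdy W u = \<i> * A (u - z0) * (1 - G (u - z0) (cnj (u - z0)))" if "u \<in> ball z0 s" for u
  proof -
    have "w differentiable (at (u - z0))" using w(3)[of 1] in_ball[OF that] by simp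
    then show "pdx W u = A (u - z0) * (1 + G (u - z0) (cnj (u - z0)))"
      "pdy W u = \<i> * A (u - z0) * (1 - G (u - z0) (cnj (u - z0)))"
      using pd_compose[of "\<lambda>u. u - z0" u w] transl[of u] w(5,6)[OF in_ball[OF that]]
      by (simp_all add: W_def[abs_def])
  qed
  show ?thesis
  proof (rule that[OF w(1) _ Ck_W])
    show "ball z0 s \<subseteq> S" using sub by blast
    fix u assume u: "u \<in> ball z0 s"
    define a where "a = A (u - z0)"
    define \<mu> where "\<mu> = G (u - z0) (cnj (u - z0))"
    have W: "pdx W u = a * (1 + \<mu>)" "pdy W u = \<i> * a * (1 - \<mu>)"
      using pdW[OF u] by (simp_all add: a_def \<mu>_def)
    have a: "a \<noteq> 0" using w(4)[OF in_ball[OF u]] by (simp add: a_def)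
    have ur: "u - z0 \<in> ball 0 r" using in_ball[OF u] w(2) by auto
    have "(cmod \<mu>)\<^sup>2 < 1\<^sup>2" using G1[OF ur] unfolding \<mu>_def by (intro power_strict_mono) auto
    moreover have "jacobian W u = (cmod a)\<^sup>2 * (1 - (cmod \<mu>)\<^sup>2)"
      unfolding jacobian_def W cmod_power2 by (simp add: power2_eq_square) (simp add: algebra_simps)
    ultimately show "jacobian W u > 0" using a by simp
    let ?E = "pdx X u \<bullet> pdx X u" and ?F = "pdx X u \<bullet> pdy X u" and ?G = "pdy X u \<bullet> pdy X u"
    have C: "Complex (?E - ?G) (- (2 * ?F)) = of_real ?E - of_real ?G - 2 * \<i> * of_real ?F"
      "cnj (Complex (?E - ?G) (- (2 * ?F))) = of_real ?E - of_real ?G + 2 * \<i> * of_real ?F"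
      by (simp_all add: complex_eq_iff)
    have "(of_real ?E - of_real ?G - 2 * \<i> * of_real ?F) * \<mu>\<^sup>2
        - 2 * (of_real ?E + of_real ?G) * \<mu> + (of_real ?E - of_real ?G + 2 * \<i> * of_real ?F) = 0"
      using G2[OF ur] gradient_form_metric(1,2)[OF sub[OF u]] by (simp add: \<mu>_def C)
    moreover have "(pdy W u)\<^sup>2 * of_real ?E - 2 * pdx W u * pdy W u * of_real ?F + (pdx W u)\<^sup>2 * of_real ?G
       = - (a\<^sup>2 * ((of_real ?E - of_real ?G - 2 * \<i> * of_real ?F) * \<mu>\<^sup>2
        - 2 * (of_real ?E + of_real ?G) * \<mu> + (of_real ?E - of_real ?G + 2 * \<i> * of_real ?F)))"
      unfolding W by (simp add: power2_eq_square algebra_simps)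
    ultimately show "(pdy W u)\<^sup>2 * of_real ?E - 2 * pdx W u * pdy W u * of_real ?F
        + (pdx W u)\<^sup>2 * of_real ?G = 0" by simp
  qed
qed

text \<open>The chart is X composed with the inverse of the isothermal coordinate W, on a disc where
  both X and W are injective; its transition map is then W itself.\<close>

lemma isothermal_parametrization_exists:
  assumes imm: "immersion_on X S" and z0: "z0 \<in> S"
  shows "\<exists>U Y V. z0 \<in> U \<and> isothermal_parametrization X U Y V"
proof -
  have imm0: "pdx X z \<times> pdy X z \<noteq> 0" if "z \<in> S" for z
    using imm that by (simp add: immersion_on_def)
  obtain s W where W: "0 < s" "ball z0 s \<subseteq> S" "\<And>k. Ck_on k W (ball z0 s)"
    and J: "\<And>u. u \<in> ball z0 s \<Longrightarrow> jacobian W u > 0"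
    and null: "\<And>u. u \<in> ball z0 s \<Longrightarrow> (pdy W u)\<^sup>2 * of_real (pdx X u \<bullet> pdx X u)
       - 2 * pdx W u * pdy W u * of_real (pdx X u \<bullet> pdy X u) + (pdx W u)\<^sup>2 * of_real (pdy X u \<bullet> pdy X u) = 0"
    by (rule isothermal_coordinate_exists[OF z0 imm0[OF z0]]) blast
  have z0s: "z0 \<in> ball z0 s" using W(1) by simp
  obtain d1 where d1: "d1 > 0" "ball z0 d1 \<subseteq> ball z0 s" "inj_on W (ball z0 d1)"
  proof (rule Ck_on_locally_injective[OF open_ball z0s W(3)])
    fix h assume h: "Re h *\<^sub>R pdx W z0 + Im h *\<^sub>R pdy W z0 = 0"
    have "Re h * Re (pdx W z0) + Im h * Re (pdy W z0) = 0" "Re h * Im (pdx W z0) + Im h * Im (pdy W z0) = 0"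
      using arg_cong[OF h, of Re] arg_cong[OF h, of Im] by simp_all
    then have "Re h * jacobian W z0 = 0" "Im h * jacobian W z0 = 0"
      unfolding jacobian_def by algebra+
    then show "h = 0" using J[OF z0s] by (simp add: complex_eq_iff)
  qed blast
  obtain d2 where d2: "d2 > 0" "ball z0 d2 \<subseteq> S" "inj_on X (ball z0 d2)"
  proof (rule Ck_on_locally_injective[OF S z0 Ck_on_harmonic_surface])
    fix h assume h: "Re h *\<^sub>R pdx X z0 + Im h *\<^sub>R pdy X z0 = 0"
    have "Re h *\<^sub>R (pdx X z0 \<times> pdy X z0) = 0" "Im h *\<^sub>R (pdx X z0 \<times> pdy X z0) = 0"
      using cross_scaled[of "Re h" "pdx X z0" "Im h" "pdy X z0" 0 1]
        cross_scaled[of 1 "pdx X z0" 0 "pdy X z0" "Re h" "Im h"] h by simp_all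
    then show "h = 0" using imm0[OF z0] by (simp add: complex_eq_iff)
  qed blast
  define U where "U = ball z0 (min d1 d2)"
  have U: "open U" "connected U" "z0 \<in> U" "U \<subseteq> ball z0 s" "U \<subseteq> S" "inj_on W U" "inj_on X U"
    using d1 d2 by (auto simp: U_def intro: inj_on_subset)
  have CkW: "Ck_on k W U" for k using W(3) U(4) by (rule Ck_on_subset)
  have CkX: "Ck_on k X U" for k using Ck_on_harmonic_surface U(5) by (rule Ck_on_subset)
  have JU: "jacobian W u > 0" if "u \<in> U" for u using J U(4) that by blast
  define V where "V = W ` U"
  have contW: "continuous_on U W" using CkW[of 0] by simp
  have V: "open V" "connected V"
    \<comment> \<open>W is continuous and injective on an open set of the plane, so its image is
      open.\<close>
    unfolding V_def using invariance_of_domain[OF contW U(1,6)] connected_continuous_image[OF contW U(2)] by auto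
  define v where "v = the_inv_into U W"
  have v: "v (W u) = u" if "u \<in> U" for u using the_inv_into_f_f[OF U(6) that] by (simp add: v_def)
  have Ckv: "Ck_on k v V" for k
  proof -
    have "Ck_on (Suc k) v (W ` U)"
      using V(1) JU by (intro Ck_on_inverse_function[OF U(1) _ CkW v]) (auto simp: V_def less_imp_neq[symmetric])
    then show ?thesis unfolding V_def by (rule Ck_on_SucD)
  qed
  define Y where "Y y = X (v y)" for y
  have YW: "Y (W u) = X u" if "u \<in> U" for u using v[OF that] by (simp add: Y_def)
  have CkY: "Ck_on k Y V" for k
    unfolding Y_def[abs_def]
    by (rule Ck_on_compose[OF V(1) U(1) _ Ckv CkX]) (auto simp: V_def v)
  have injY: "inj_on Y V"
    using U(7) by (auto simp: inj_on_def V_def YW)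
  have imgY: "Y ` V = X ` U" unfolding V_def image_image by (rule image_cong) (auto simp: YW)
  have trans: "transition Y V X u = W u" if "u \<in> U" for u
    using the_inv_into_f_f[OF injY, of "W u"] that by (simp add: transition_def YW V_def)
  have fac: "pdx X u = Re (pdx W u) *\<^sub>R pdx Y (W u) + Im (pdx W u) *\<^sub>R pdy Y (W u)"
    "pdy X u = Re (pdy W u) *\<^sub>R pdx Y (W u) + Im (pdy W u) *\<^sub>R pdy Y (W u)"
    "pdx X u \<times> pdy X u = jacobian W u *\<^sub>R (pdx Y (W u) \<times> pdy Y (W u))" if "u \<in> U" for u
  proof -
    have "W differentiable (at u)" "Y differentiable (at (W u))"
      using CkW[of 1] CkY[of 1] that by (auto simp: V_def)
    note factor_through[OF U(1) that YW this]
    then show "pdx X u = Re (pdx W u) *\<^sub>R pdx Y (W u) + Im (pdx W u) *\<^sub>R pdy Y (W u)"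
    "pdy X u = Re (pdy W u) *\<^sub>R pdx Y (W u) + Im (pdy W u) *\<^sub>R pdy Y (W u)"
    "pdx X u \<times> pdy X u = jacobian W u *\<^sub>R (pdx Y (W u) \<times> pdy Y (W u))" by blast+
  qed
  have conf: "norm (pdx Y (W u)) = norm (pdy Y (W u))" "pdx Y (W u) \<bullet> pdy Y (W u) = 0" if "u \<in> U" for u
  proof -
    have "Re (pdx W u) * Im (pdy W u) - Im (pdx W u) * Re (pdy W u) \<noteq> 0"
      using JU[OF that] by (simp add: jacobian_def)
    note conformal_of_pullback_null[OF this fac(1,2)[OF that]]
    then show "norm (pdx Y (W u)) = norm (pdy Y (W u))" "pdx Y (W u) \<bullet> pdy Y (W u) = 0"
      using null[of u] U(4) that by (auto simp: norm_eq)
  qed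
  have "isothermal_on Y V"
    unfolding isothermal_on_def smooth_on_def immersion_on_def
  proof (intro conjI ballI allI)
    fix y assume "y \<in> V"
    then obtain u where u: "u \<in> U" "y = W u" by (auto simp: V_def)
    show "pdx Y y \<times> pdy Y y \<noteq> 0" using fac(3)[OF u(1)] imm0[of u] u U(5) by auto
    show "norm (pdx Y y) = norm (pdy Y y)" "pdx Y y \<bullet> pdy Y y = 0" using conf u by auto
  qed (rule CkY)
  moreover have "smooth_on (transition Y V X) U"
    unfolding smooth_on_def
    by (intro allI, rule Ck_on_cong[OF U(1) _ CkW]) (simp add: trans)
  moreover have "gauss_map Y (transition Y V X u) = gauss_map X u" if "u \<in> U" for u
    using JU[OF that] unfolding gauss_map_def trans[OF that] fac(3)[OF that] by simp
  ultimately have "isothermal_parametrization X U Y V"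
    unfolding isothermal_parametrization_def domain_def using U V injY imgY by auto
  then show ?thesis using U(3) by blast
qed

text \<open>The description is resolved by both halves: a chart exists, and every chart gives the
  value determined by the distortion of X.\<close>

lemma surface_dilatation_eq:
  assumes imm: "immersion_on X S" and z: "z \<in> S"
  shows "surface_dilatation X z = sqrt ((distortion X z - 1) / (distortion X z + 1))"
  unfolding surface_dilatation_def
proof (rule the_equality)
  have "pdx X z \<times> pdy X z \<noteq> 0" using imm z by (simp add: immersion_on_def)
  note dil = dilatation_transition[OF _ _ this]
  show "\<exists>U Y V. z \<in> U \<and> isothermal_parametrization X U Y V \<and>
      sqrt ((distortion X z - 1) / (distortion X z + 1)) = dilatation (transition Y V X) z"
    using isothermal_parametrization_exists[OF imm z] dil by metis
  show "d = sqrt ((distortion X z - 1) / (distortion X z + 1))"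
    if "\<exists>U Y V. z \<in> U \<and> isothermal_parametrization X U Y V \<and> d = dilatation (transition Y V X) z" for d
    using that dil by blast
qed

text \<open>L and M are n.X_xx and n.X_xy. Differentiating n.X_x = 0 and n.X_y = 0 gives the four
  products, and harmonicity replaces n.X_yy by -L.\<close>

lemma gauss_map_derivatives:
  assumes imm: "immersion_on X S" and z: "z \<in> S"
  obtains L M where "gauss_map X differentiable (at z)"
    and "gauss_map X z \<bullet> pdx (gauss_map X) z = 0" "gauss_map X z \<bullet> pdy (gauss_map X) z = 0"
    and "pdx (gauss_map X) z \<bullet> pdx X z = - L" "pdx (gauss_map X) z \<bullet> pdy X z = - M"
    and "pdy (gauss_map X) z \<bullet> pdx X z = - M" "pdy (gauss_map X) z \<bullet> pdy X z = L"
proof -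
  let ?n = "gauss_map X"
  have imm0: "pdx X z \<times> pdy X z \<noteq> 0" if "z \<in> S" for z
    using imm that by (simp add: immersion_on_def)
  have C2: "Ck_on 2 X S" by (rule Ck_on_harmonic_surface)
  have dX: "pdx X differentiable (at w)" "pdy X differentiable (at w)" if "w \<in> S" for w
    using C2 that by (auto simp: numeral_2_eq_2)
  have bil: "bounded_bilinear (\<times>)" by (simp add: bilinear_conv_bounded_bilinear[symmetric] bilinear_cross)
  have dW: "(\<lambda>w. pdx X w \<times> pdy X w) differentiable (at z)"
    using bounded_bilinear.FDERIV[OF bil has_derivative_pd[OF dX(1)[OF z]] has_derivative_pd[OF dX(2)[OF z]]]
    by (auto simp: differentiable_def)
  have dn: "?n differentiable (at z)"
    unfolding gauss_map_def[abs_def] using dW imm0[OF z]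
    by (intro differentiable_scaleR differentiable_inverse differentiable_norm_at differentiable_compose[of norm]) auto
  have prod: "?n z \<bullet> pdx f z + pdx ?n z \<bullet> f z = 0 \<and> ?n z \<bullet> pdy f z + pdy ?n z \<bullet> f z = 0"
    if f: "f differentiable (at z)" and c: "\<And>w. w \<in> S \<Longrightarrow> ?n w \<bullet> f w = c" for f c
  proof -
    have "(\<lambda>w. ?n w \<bullet> f w) differentiable (at z)
        \<and> pdx (\<lambda>w. ?n w \<bullet> f w) z = ?n z \<bullet> pdx f z + pdx ?n z \<bullet> f z
        \<and> pdy (\<lambda>w. ?n w \<bullet> f w) z = ?n z \<bullet> pdy f z + pdy ?n z \<bullet> f z"
      by (rule has_derivative_pdI[OF has_derivative_inner[OF has_derivative_pd[OF dn] has_derivative_pd[OF f]]])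
        (simp add: algebra_simps)
    moreover have "pdx (\<lambda>w. ?n w \<bullet> f w) z = 0" "pdy (\<lambda>w. ?n w \<bullet> f w) z = 0"
      using pd_cong[OF S z, of "\<lambda>w. ?n w \<bullet> f w" "\<lambda>w. c"] c
        pd_of_has_derivative[OF has_derivative_const[of c "at z"]] by auto
    ultimately show ?thesis by simp
  qed
  have unit: "?n w \<bullet> ?n w = 1" if "w \<in> S" for w
  proof -
    have "norm (?n w) = 1" using imm0[OF that] by (simp add: gauss_map_def)
    then show ?thesis by (simp add: norm_eq_1)
  qed
  have tang: "?n w \<bullet> pdx X w = 0" "?n w \<bullet> pdy X w = 0" for w
    by (simp_all add: gauss_map_def dot_cross_self)
  note p1 = prod[OF dn unit] and p2 = prod[OF dX(1)[OF z] tang(1)] and p3 = prod[OF dX(2)[OF z] tang(2)]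
  \<comment> \<open>Both identities are read off from the derivative g' of the holomorphic function
    \<open>gradient_form\<close>: componentwise X_xx is Re g', X_yy is -Re g', and both mixed
    derivatives are -Im g'.\<close>
  have second: "pdx (pdx X) z + pdy (pdy X) z = 0" "pdx (pdy X) z = pdy (pdx X) z"
  proof -
    let ?g = "\<lambda>i. gradient_form X i"
    have g: "(\<lambda>w. Re (?g i w)) differentiable (at z) \<and> pdx (\<lambda>w. Re (?g i w)) z = Re (deriv (?g i) z)
        \<and> pdy (\<lambda>w. Re (?g i w)) z = - Im (deriv (?g i) z)"
      "(\<lambda>w. - Im (?g i w)) differentiable (at z) \<and> pdx (\<lambda>w. - Im (?g i w)) z = - Im (deriv (?g i) z)
        \<and> pdy (\<lambda>w. - Im (?g i w)) z = - Re (deriv (?g i) z)" for i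
    proof -
      have d: "(?g i has_derivative (\<lambda>h. deriv (?g i) z * h)) (at z)"
        using holomorphic_derivI[OF gradient_form_holomorphic S z] by (simp add: has_field_derivative_def)
      show "(\<lambda>w. Re (?g i w)) differentiable (at z) \<and> pdx (\<lambda>w. Re (?g i w)) z = Re (deriv (?g i) z)
        \<and> pdy (\<lambda>w. Re (?g i w)) z = - Im (deriv (?g i) z)"
        by (rule has_derivative_pdI[OF bounded_linear.has_derivative[OF bounded_linear_Re d]]) simp
      show "(\<lambda>w. - Im (?g i w)) differentiable (at z) \<and> pdx (\<lambda>w. - Im (?g i w)) z = - Im (deriv (?g i) z)
        \<and> pdy (\<lambda>w. - Im (?g i w)) z = - Re (deriv (?g i) z)"
        by (rule has_derivative_pdI[OF bounded_linear.has_derivative[OF bounded_linear_minus[OF bounded_linear_Im] d]])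
          simp
    qed
    have "pdx (pdx X) z = pdx (\<lambda>w. \<chi> i. Re (?g i w)) z" "pdy (pdx X) z = pdy (\<lambda>w. \<chi> i. Re (?g i w)) z"
      "pdx (pdy X) z = pdx (\<lambda>w. \<chi> i. - Im (?g i w)) z" "pdy (pdy X) z = pdy (\<lambda>w. \<chi> i. - Im (?g i w)) z"
      using pd_gradient_form by (intro pd_cong[OF S z]; simp)+
    then show "pdx (pdx X) z + pdy (pdy X) z = 0" "pdx (pdy X) z = pdy (pdx X) z"
      using pd_vec[of "\<lambda>w. \<chi> i. Re (?g i w)" z] pd_vec[of "\<lambda>w. \<chi> i. - Im (?g i w)" z] g
      by (simp_all add: vec_eq_iff)
  qed
  have "?n z \<bullet> pdx (pdx X) z + ?n z \<bullet> pdy (pdy X) z = 0"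
    using second(1) by (simp add: inner_add_right[symmetric])
  then show ?thesis
    using p1 p2 p3 second(2) by (intro that[of "?n z \<bullet> pdx (pdx X) z" "?n z \<bullet> pdx (pdy X) z"] dn)
      (auto simp: inner_commute[of "pdx ?n z" "?n z"] inner_commute[of "pdy ?n z" "?n z"])
qed

end

text \<open>Rotations preserve inner products and commute with the cross product, so all hypotheses
  pass to the rotated map and its distortion is unchanged.\<close>

lemma spherical_dilatation_eq:
  fixes n :: "complex \<Rightarrow> real^3"
  assumes diff: "n differentiable (at z)" and unit: "norm (n z) = 1"
    and orth: "n z \<bullet> pdx n z = 0" "n z \<bullet> pdy n z = 0"
    and cross: "pdx n z \<times> pdy n z = (- \<kappa>) *\<^sub>R n z" "\<kappa> > 0"
  shows "spherical_dilatation n z = sqrt ((distortion n z - 1) / (distortion n z + 1))"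
proof -
  define R where "R = projecting_rotation (n z)"
  have R: "rotation_matrix R \<and> R *v n z \<noteq> north_pole"
  proof (cases "n z = north_pole")
    case False
    then show ?thesis by (simp add: R_def projecting_rotation_def rotation_matrix_def orthogonal_matrix_id)
  next
    case True
    \<comment> \<open>A rotation moving the third axis to the first shows that the choice in
      \<open>projecting_rotation\<close> is proper at the north pole.\<close>
    obtain A :: "real^3^3" where "rotation_matrix A" "A *v axis 3 1 = axis 1 1"
      using rotation_matrix_exists_basis[of "axis 1 1 :: real^3" 3] by auto
    moreover have "n z = axis 3 1" using True by (simp add: north_pole_def vec_eq_iff forall_3 axis_def)
    moreover have "axis 1 1 \<noteq> north_pole" by (simp add: north_pole_def vec_eq_iff forall_3 axis_def)
    ultimately have "\<exists>R. rotation_matrix R \<and> R *v n z \<noteq> north_pole" by metis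
    from someI_ex[OF this] show ?thesis using True by (simp add: R_def projecting_rotation_def)
  qed
  then have orthR: "orthogonal_transformation ((*v) R)"
    by (simp add: rotation_matrix_def orthogonal_transformation_matrix)
  define m where "m w = R *v n w" for w
  have bl: "bounded_linear ((*v) R)" by (simp add: linear_conv_bounded_linear[symmetric])
  have pd: "m differentiable (at z) \<and> pdx m z = R *v pdx n z \<and> pdy m z = R *v pdy n z"
    unfolding m_def[abs_def]
    by (rule has_derivative_pdI[OF bounded_linear.has_derivative[OF bl has_derivative_pd[OF diff]]])
      (simp add: matrix_vector_right_distrib matrix_vector_mult_scaleR)
  have cr: "pdx m z \<times> pdy m z = R *v (pdx n z \<times> pdy n z)"
    using pd cross_rotation_matrix R by simp
  have inn: "(R *v x) \<bullet> (R *v y) = x \<bullet> y" and nrm: "norm (R *v x) = norm x" for x y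
    using orthR by (auto simp: orthogonal_transformation_def orthogonal_transformation_norm)
  have dist: "distortion m z = distortion n z"
    unfolding distortion_def cr using pd nrm by simp
  have "dilatation (\<lambda>w. stereographic (m w)) z = sqrt ((distortion m z - 1) / (distortion m z + 1))"
  proof (rule stereographic_dilatation)
    show "pdx m z \<times> pdy m z = (- \<kappa>) *\<^sub>R m z"
      unfolding cr cross(1) m_def by (rule matrix_vector_mult_scaleR)
  qed (use pd inn nrm R orth unit cross(2) in \<open>simp_all add: m_def[of z]\<close>)
  then show ?thesis by (simp add: spherical_dilatation_def m_def dist R_def)
qed

theorem theorem1p1:
  fixes \<Omega> :: "complex set" and X :: "complex \<Rightarrow> real^3"
  assumes "domain \<Omega>" and "regular_harmonic_surface X \<Omega>"
  shows "\<forall>z\<in>\<Omega>. pdx (gauss_map X) z \<times> pdy (gauss_map X) z \<noteq> 0 \<longrightarrow>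
           distortion (gauss_map X) z = distortion X z \<and>
           surface_dilatation X z = spherical_dilatation (gauss_map X) z"
proof (intro ballI impI)
  fix z assume z: "z \<in> \<Omega>" and reg: "pdx (gauss_map X) z \<times> pdy (gauss_map X) z \<noteq> 0"
  have \<Omega>: "open \<Omega>" and harm: "\<And>i. harmonic_on (\<lambda>z. X z $ i) \<Omega>" and imm: "immersion_on X \<Omega>"
    using assms by (auto simp: domain_def regular_harmonic_surface_def)
  have W: "pdx X z \<times> pdy X z \<noteq> 0" using imm z by (simp add: immersion_on_def)
  obtain L M where n: "gauss_map X differentiable (at z)"
    and orth: "gauss_map X z \<bullet> pdx (gauss_map X) z = 0" "gauss_map X z \<bullet> pdy (gauss_map X) z = 0"
    and II: "pdx (gauss_map X) z \<bullet> pdx X z = - L" "pdx (gauss_map X) z \<bullet> pdy X z = - M"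
      "pdy (gauss_map X) z \<bullet> pdx X z = - M" "pdy (gauss_map X) z \<bullet> pdy X z = L"
    by (rule gauss_map_derivatives[OF \<Omega> harm imm z]) blast
  note alg = gauss_map_distortion_algebra[OF W gauss_map_def[of X z] orth II]
  have dist: "distortion (gauss_map X) z = distortion X z"
    using alg(3)[OF reg] by (simp add: distortion_def)
  \<comment> \<open>Regularity of the Gauss map excludes L = M = 0; this quotient is the \<kappa> of
    \<open>spherical_dilatation_eq\<close>.\<close>
  have "(L\<^sup>2 + M\<^sup>2) / norm (pdx X z \<times> pdy X z) > 0" using alg(2)[OF reg] W by simp
  moreover have "norm (gauss_map X z) = 1" using W by (simp add: gauss_map_def)
  ultimately have "spherical_dilatation (gauss_map X) z
      = sqrt ((distortion (gauss_map X) z - 1) / (distortion (gauss_map X) z + 1))"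
    using spherical_dilatation_eq[OF n _ orth alg(1)] by blast
  then show "distortion (gauss_map X) z = distortion X z \<and>
      surface_dilatation X z = spherical_dilatation (gauss_map X) z"
    using surface_dilatation_eq[OF \<Omega> harm imm z] dist by simp
qed

end
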